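(* Let the number $p$ of parameters be fixed, and let $0<\varepsilon<1$ and $0<\beta\le 1$. For an instance $\Pi=(\mathcal{M},w,\ell,\Lambda)$ of the multi-parametric matroid $\ell$-interdiction problem and a cell $c\subseteq\Lambda$ of the arrangement $A(H^=)$, the running time of the Cell Algorithm (described in the context) is bounded by a polynomial in $\varepsilon^{-1}$, the encoding length of the instance $\Pi$, and the running time of the oracle $\mathsf{ORC}_\beta$.
   Context: Setting. $\mathcal{M}=(E,\mathcal{F})$ is a matroid with finite ground set $E$, $|E|=m$, independent sets $\mathcal F$ and rank $k$; $\ell\in\mathbb{N}_{>0}$; $p\ge 1$ is the number of parameters, which is fixed, whereas $m,k,q,\ell$ are part of the input. Each $e\in E$ has the weight $w(e,\lambda)=a_e+\lambda_1b_{1,e}+\dots+\lambda_pb_{p,e}$ with rational $a_e,b_{1,e},\dots,b_{p,e}$, where $\lambda=(\lambda_1,\dots,\lambda_p)$ ranges over a parameter polytope $\Lambda\subseteq\mathbb{R}^p$ defined by $q$ half-spaces. The weight of a basis is $w(B,\lambda)=\sum_{e\in B}w(e,\lambda)$. For $F\subseteq E$ let $\mathcal{M}_F$ be the restriction of $\mathcal{M}$ to $E\setminus F$, let $B_\lambda^F$ be a minimum weight basis of $\mathcal{M}_F$ at $\lambda$, and let $y_F:\Lambda\to\mathbb{R}$, $y_F(\lambda)=w(B_\lambda^F,\lambda)$. The optimal interdiction value function is $y(\lambda)=\max\{y_F(\lambda):F\subseteq E,\ |F|=\ell\}$. An interdiction strategy is a set $F\subseteq E$ with $|F|=\ell$.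 The multi-parametric matroid $\ell$-interdiction problem asks, for each $\lambda\in\Lambda$, for an interdiction strategy $F^*$ with $y_{F^*}(\lambda)=y(\lambda)$, together with the value $y(\lambda)$. Standing assumptions. (a) For every $\lambda\in\Lambda$ and $F\subseteq E$ with $|F|=\ell$ there is a basis $B_\lambda^F$ of cardinality $k$. (b) No separating hyperplane $h(e,f)$ (defined below) is vertical, i.e. contains a line parallel to the $p$-th coordinate axis. (c) All $a_e,b_{1,e},\dots,b_{p,e}$ are $\ge 0$; at most $k-1$ of the values $a_e$ ($e\in E$) are zero and, for each $i=1,\dots,p$, at most $k-1$ of the values $b_{i,e}$ ($e\in E$) are zero. (d) $\Lambda$ is non-negative (contained in the non-negative orthant) and compact. Arrangement. For $e,f\in E$ with $e\neq f$, $h(e,f)=\{\lambda\in\mathbb{R}^p: w(e,\lambda)=w(f,\lambda)\}$ is the separating hyperplane, with open sides $h^<(e,f)=\{\lambda: w(e,\lambda)<w(f,\lambda)\}$ and $h^>(e,f)=\{\lambda: w(e,\lambda)>w(f,\lambda)\}$. $H^=$ is the set of all separating hyperplanes together with all facet supporting hyperplanes of $\Lambda$. The faces of the arrangement $A(H^=)$ are the nonempty sets obtained by choosing, for each hyperplane of $H^=$, either the hyperplane itself or one of its two open sides, and intersecting all these choices. A cell is a full-dimensional face contained in $\Lambda$; it is identified with its closure, a polytope. Oracle. $\mathsf{ORC}_\beta$ is an oracle that, given $\lambda\in\Lambda$, returns a set $F\subseteq E$ with $|F|=\ell$ and $y_F(\lambda)\ge\beta\,y(\lambda)$. Its running time is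 the (worst-case) time for one call made during the algorithm. Cell Algorithm. Input: $\Pi$, $\varepsilon$, $c$. (1) Choose an arbitrary point $\lambda_0$ in the relative interior of $c$ (the algorithm of Edelsbrunner, O'Rourke and Seidel for computing the cells returns such a point for each cell). For an interdiction strategy $F$ put $\varphi(F)=\{(\lambda,z)\in\mathbb{R}^{p+1}: w(B_{\lambda_0}^F,\lambda)\le z\}$. Let $F_0=\mathsf{ORC}_\beta(\lambda_0)$, $S=\{F_0\}$ and $\mathcal{A}=\{(\lambda,z):\lambda\in c,\ z\in\mathbb{R}\}\cap\varphi(F_0)$. (2) Enumerate the vertices of the polyhedron $\mathcal{A}$ (with Chazelle's optimal convex hull algorithm) and go through the vertices $(\lambda,z)$ one after the other; for each of them let $F=\mathsf{ORC}_\beta(\lambda)$, and if $(1-\varepsilon)\,w(B_{\lambda_0}^F,\lambda)>z$, then replace $S$ by $S\cup\{F\}$, replace $\mathcal{A}$ by $\mathcal{A}\cap\varphi(F)$, and restart step (2) with the new $\mathcal{A}$. (3) If all vertices of $\mathcal{A}$ have been examined without a restart, return $S$. *)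

theory Defs
  imports
    "HOL-Analysis.Analysis"
    "HOL-Computational_Algebra.Polynomial"
    "HOL-Library.Log_Nat"
    "HOL-Library.State_Monad"
    "HOL-Library.While_Combinator"
begin

section \<open>Multi-parametric matroid interdiction\<close>

definition matroid :: "'e set \<Rightarrow> 'e set set \<Rightarrow> bool" where
  "matroid E \<F> \<longleftrightarrow> finite E \<and> \<F> \<subseteq> Pow E \<and> {} \<in> \<F> \<and>
     (\<forall>X\<in>\<F>. \<forall>Y. Y \<subseteq> X \<longrightarrow> Y \<in> \<F>) \<and>
     (\<forall>X\<in>\<F>. \<forall>Y\<in>\<F>. card X < card Y \<longrightarrow> (\<exists>e\<in>Y - X. insert e X \<in> \<F>))"

text \<open>
  The number of parameters is the cardinality of the index type \<open>'p\<close>; its order is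
  used to speak about the last coordinate and to traverse the coordinates. All numbers of an instance are rational.
  A half-space \<open>(u, t)\<close> stands for all \<open>\<mu>\<close> with \<open>u \<bullet> \<mu> \<le> t\<close>.
  The bit string \<open>matroid_code\<close> is the form in which an algorithm gets the matroid,
  see \<open>encodes_matroid\<close> below.
\<close>

type_synonym 'p ratvec = "rat ^ 'p"

record ('e, 'p::finite) interdiction =
  elements :: "'e list"
  indeps :: "'e set set"
  matroid_code :: "bool list"
  const_coeff :: "'e \<Rightarrow> rat"
  lin_coeff :: "'e \<Rightarrow> 'p ratvec"
  budget :: nat
  param_halfspaces :: "('p ratvec \<times> rat) list"

definition real_vec :: "'p::finite ratvec \<Rightarrow> real ^ 'p" where
  "real_vec v = (\<chi> i. of_rat (v $ i))"

definition ground :: "('e, 'p::finite) interdiction \<Rightarrow> 'e set" where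
  "ground I = set (elements I)"

definition rank :: "('e, 'p::finite) interdiction \<Rightarrow> nat" where
  "rank I = Max (card ` indeps I)"

definition weight :: "('e, 'p::finite) interdiction \<Rightarrow> 'e \<Rightarrow> real ^ 'p \<Rightarrow> real" where
  "weight I e \<mu> = of_rat (const_coeff I e) + (\<Sum>i\<in>UNIV. \<mu> $ i * of_rat (lin_coeff I e $ i))"

definition set_weight :: "('e, 'p::finite) interdiction \<Rightarrow> 'e set \<Rightarrow> real ^ 'p \<Rightarrow> real" where
  "set_weight I B \<mu> = (\<Sum>e\<in>B. weight I e \<mu>)"

definition region :: "('p ratvec \<times> rat) list \<Rightarrow> (real ^ 'p::finite) set" where
  "region hs = {\<mu>. \<forall>(u, t) \<in> set hs. real_vec u \<bullet> \<mu> \<le> of_rat t}"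

definition param_set :: "('e, 'p::finite) interdiction \<Rightarrow> (real ^ 'p) set" where
  "param_set I = region (param_halfspaces I)"

definition basis_without :: "('e, 'p::finite) interdiction \<Rightarrow> 'e set \<Rightarrow> 'e set \<Rightarrow> bool" where
  "basis_without I F B \<longleftrightarrow> B \<in> indeps I \<and> B \<subseteq> ground I - F \<and>
     (\<forall>e \<in> ground I - F - B. insert e B \<notin> indeps I)"

definition min_weight_basis ::
    "('e, 'p::finite) interdiction \<Rightarrow> 'e set \<Rightarrow> real ^ 'p \<Rightarrow> 'e set \<Rightarrow> bool" where
  "min_weight_basis I F \<mu> B \<longleftrightarrow> basis_without I F B \<and>
     (\<forall>B'. basis_without I F B' \<longrightarrow> set_weight I B \<mu> \<le> set_weight I B' \<mu>)"

definition strategies :: "('e, 'p::finite) interdiction \<Rightarrow> 'e set set" where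
  "strategies I = {F. F \<subseteq> ground I \<and> card F = budget I}"

definition value_without ::
    "('e, 'p::finite) interdiction \<Rightarrow> 'e set \<Rightarrow> real ^ 'p \<Rightarrow> real" where
  "value_without I F \<mu> = set_weight I (SOME B. min_weight_basis I F \<mu> B) \<mu>"

definition opt_value :: "('e, 'p::finite) interdiction \<Rightarrow> real ^ 'p \<Rightarrow> real" where
  "opt_value I \<mu> = Max ((\<lambda>F. value_without I F \<mu>) ` strategies I)"

definition separating :: "('e, 'p::finite) interdiction \<Rightarrow> 'e \<Rightarrow> 'e \<Rightarrow> (real ^ 'p) set" where
  "separating I e f = {\<mu>. weight I e \<mu> = weight I f \<mu>}"

text \<open>
  If two elements have equal linear coefficients, then \<open>separating I e f\<close> is empty or the
  whole space. Such pairs are not counted as hyperplanes, neither in the condition on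
  vertical hyperplanes nor in the arrangement.
\<close>

definition standing_assumptions :: "('e, 'p::{finite, linorder}) interdiction \<Rightarrow> bool" where
  "standing_assumptions I \<longleftrightarrow>
     (\<forall>\<mu>\<in>param_set I. \<forall>F\<in>strategies I.
        \<exists>B. min_weight_basis I F \<mu> B \<and> card B = rank I) \<and>
     (\<forall>e\<in>ground I. \<forall>f\<in>ground I. lin_coeff I e \<noteq> lin_coeff I f \<longrightarrow>
        \<not> (\<exists>x. range (\<lambda>s. x + s *\<^sub>R axis (Max UNIV) 1) \<subseteq> separating I e f)) \<and>
     (\<forall>e\<in>ground I. 0 \<le> const_coeff I e \<and> (\<forall>i. 0 \<le> lin_coeff I e $ i)) \<and>
     card {e\<in>ground I. const_coeff I e = 0} < rank I \<and>
     (\<forall>i. card {e\<in>ground I. lin_coeff I e $ i = 0} < rank I) \<and>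
     (\<forall>\<mu>\<in>param_set I. \<forall>i. 0 \<le> \<mu> $ i) \<and>
     compact (param_set I)"


section \<open>The arrangement and its cells\<close>

definition arrangement_hyperplanes :: "('e, 'p::finite) interdiction \<Rightarrow> (real ^ 'p) set set" where
  "arrangement_hyperplanes I =
     {separating I e f | e f. e \<in> ground I \<and> f \<in> ground I \<and> lin_coeff I e \<noteq> lin_coeff I f} \<union>
     {affine hull G | G. G facet_of param_set I}"

text \<open>
  The hyperplane itself and its two open sides; the second side is obtained from the
  description of the hyperplane by \<open>- u\<close> and \<open>- t\<close>.
\<close>

definition sides :: "(real ^ 'p::finite) set \<Rightarrow> (real ^ 'p) set set" where
  "sides H = insert H {{\<mu>. u \<bullet> \<mu> < t} | u t. u \<noteq> 0 \<and> H = {\<mu>. u \<bullet> \<mu> = t}}"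

definition arrangement_face :: "('e, 'p::finite) interdiction \<Rightarrow> (real ^ 'p) set \<Rightarrow> bool" where
  "arrangement_face I C \<longleftrightarrow> C \<noteq> {} \<and>
     (\<exists>side. (\<forall>H\<in>arrangement_hyperplanes I. side H \<in> sides H) \<and>
             C = \<Inter> (side ` arrangement_hyperplanes I))"

definition cell :: "('e, 'p::finite) interdiction \<Rightarrow> (real ^ 'p) set \<Rightarrow> bool" where
  "cell I c \<longleftrightarrow> (\<exists>C. arrangement_face I C \<and> aff_dim C = int CARD('p) \<and>
     C \<subseteq> param_set I \<and> c = closure C)"

text \<open>
  An algorithm gets a cell as a list, without repetitions, of half-spaces bounded by
  the separating hyperplanes and of half-spaces defining the parameter polytope.
  The pair \<open>(e, f)\<close> contributes the half-space \<open>w(e,\<mu>) \<le> w(f,\<mu>)\<close>.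
\<close>

definition arrangement_halfspaces :: "('e, 'p::finite) interdiction \<Rightarrow> ('p ratvec \<times> rat) set" where
  "arrangement_halfspaces I =
     {(lin_coeff I e - lin_coeff I f, const_coeff I f - const_coeff I e) | e f.
        e \<in> ground I \<and> f \<in> ground I \<and> e \<noteq> f} \<union> set (param_halfspaces I)"

definition describes_cell ::
    "('e, 'p::finite) interdiction \<Rightarrow> (real ^ 'p) set \<Rightarrow> ('p ratvec \<times> rat) list \<Rightarrow> bool" where
  "describes_cell I c hs \<longleftrightarrow>
     distinct hs \<and> set hs \<subseteq> arrangement_halfspaces I \<and> region hs = c"


section \<open>Encoding lengths\<close>

definition int_length :: "int \<Rightarrow> nat" where
  "int_length z = 1 + nat (bitlen \<bar>z\<bar>)"

definition rat_length :: "rat \<Rightarrow> nat" where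
  "rat_length x = (case quotient_of x of (n, d) \<Rightarrow> int_length n + int_length d)"

definition vec_length :: "'p::finite ratvec \<Rightarrow> nat" where
  "vec_length v = (\<Sum>i\<in>UNIV. rat_length (v $ i))"

definition encoding_length :: "('e, 'p::finite) interdiction \<Rightarrow> nat" where
  "encoding_length I =
     length (matroid_code I) + int_length (int (budget I)) +
     (\<Sum>e\<leftarrow>elements I. rat_length (const_coeff I e) + vec_length (lin_coeff I e)) +
     (\<Sum>(u, t)\<leftarrow>param_halfspaces I. vec_length u + rat_length t)"

text \<open>
  No particular encoding of matroids is fixed. An encoding is given by an independence
  test \<open>ind\<close>, which takes the code of a matroid and a set, and returns its answer together
  with its running time.
\<close>

definition encodes_matroid ::
    "(bool list \<Rightarrow> 'e set \<Rightarrow> bool \<times> nat) \<Rightarrow> ('e, 'p::finite) interdiction \<Rightarrow> bool" where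
  "encodes_matroid ind I \<longleftrightarrow>
     (\<forall>X \<subseteq> ground I. fst (ind (matroid_code I) X) \<longleftrightarrow> X \<in> indeps I)"

definition interdiction_instance ::
    "(bool list \<Rightarrow> 'e set \<Rightarrow> bool \<times> nat) \<Rightarrow> ('e, 'p::{finite, linorder}) interdiction \<Rightarrow> bool" where
  "interdiction_instance ind I \<longleftrightarrow>
     distinct (elements I) \<and> matroid (ground I) (indeps I) \<and> 0 < budget I \<and>
     encodes_matroid ind I \<and> standing_assumptions I"


section \<open>Subroutines\<close>

text \<open>
  A subroutine is a function that returns its result together with its running time.
\<close>

definition polynomial_independence_test :: "(bool list \<Rightarrow> 'e set \<Rightarrow> bool \<times> nat) \<Rightarrow> bool" where
  "polynomial_independence_test ind \<longleftrightarrow>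
     (\<exists>Q :: nat poly. \<forall>d X. finite X \<longrightarrow> snd (ind d X) \<le> poly Q (length d + card X))"

text \<open>
  The algorithm of Edelsbrunner, O'Rourke and Seidel, for a fixed number of parameters.
\<close>

definition interior_point_routine ::
    "(bool list \<Rightarrow> 'e set \<Rightarrow> bool \<times> nat) \<Rightarrow>
     (('e, 'p::{finite, linorder}) interdiction \<Rightarrow> ('p ratvec \<times> rat) list \<Rightarrow> 'p ratvec \<times> nat) \<Rightarrow>
     bool" where
  "interior_point_routine ind pick \<longleftrightarrow>
     (\<exists>Q :: nat poly. \<forall>I c hs.
        interdiction_instance ind I \<and> cell I c \<and> describes_cell I c hs \<longrightarrow>
        (case pick I hs of (\<mu>\<^sub>0, t) \<Rightarrow>
           real_vec \<mu>\<^sub>0 \<in> rel_interior c \<and> vec_length \<mu>\<^sub>0 \<le> t \<and> t \<le> poly Q (encoding_length I)))"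

type_synonym 'p point = "'p ratvec \<times> rat"
type_synonym 'p halfspace = "'p point \<times> rat"

definition real_point :: "'p::finite point \<Rightarrow> (real ^ 'p) \<times> real" where
  "real_point x = (real_vec (fst x), of_rat (snd x))"

definition point_length :: "'p::finite point \<Rightarrow> nat" where
  "point_length x = vec_length (fst x) + rat_length (snd x)"

definition halfspace_length :: "'p::finite halfspace \<Rightarrow> nat" where
  "halfspace_length h = point_length (fst h) + rat_length (snd h)"

definition point_region :: "'p::finite halfspace list \<Rightarrow> ((real ^ 'p) \<times> real) set" where
  "point_region A = {x. \<forall>(u, t) \<in> set A. real_point u \<bullet> x \<le> of_rat t}"

text \<open>
  Chazelle's algorithm enumerates the vertices of a full-dimensional polyhedron given by
  \<open>n\<close> half-spaces in dimension \<open>d\<close> with \<open>O(n log n + n ^ (d div 2))\<close> arithmetic operations;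
  here \<open>d = CARD('p) + 1\<close>. The factor \<open>poly Q L\<close> is the cost of one operation, where \<open>L\<close>
  is the largest encoding length of an input half-space. Writing down the result is part of
  the running time.
\<close>

definition chazelle_enumeration ::
    "('p::finite halfspace list \<Rightarrow> 'p point list \<times> nat) \<Rightarrow> bool" where
  "chazelle_enumeration enum \<longleftrightarrow>
     (\<exists>Q :: nat poly. \<forall>A. A \<noteq> [] \<and> interior (point_region A) \<noteq> {} \<longrightarrow>
        (case enum A of (vs, t) \<Rightarrow>
           distinct vs \<and>
           real_point ` set vs = {v. v extreme_point_of point_region A} \<and>
           (\<Sum>v\<leftarrow>vs. point_length v) \<le> t \<and>
           real t \<le> (real (length A) * log 2 (length A) + real (length A) ^ ((CARD('p) + 1) div 2)) *
                    poly Q (Max (halfspace_length ` set A))))"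

text \<open>
  The oracle answers a point \<open>\<mu>\<close> by a strategy, together with the time of the call.
\<close>

definition approx_oracle ::
    "real \<Rightarrow> ('e, 'p::finite) interdiction \<Rightarrow> ('p ratvec \<Rightarrow> 'e set \<times> nat) \<Rightarrow> bool" where
  "approx_oracle \<beta> I orc \<longleftrightarrow>
     (\<forall>\<mu>. real_vec \<mu> \<in> param_set I \<longrightarrow>
        fst (orc \<mu>) \<in> strategies I \<and>
        \<beta> * opt_value I (real_vec \<mu>) \<le> value_without I (fst (orc \<mu>)) (real_vec \<mu>))"


section \<open>The cost model\<close>

text \<open>
  Programs run in a state monad over a clock, which counts the elapsed time and remembers
  the duration of the slowest oracle call so far. An arithmetic operation or comparison
  is charged \<open>poly \<kappa> n\<close>, where \<open>n\<close> is the total encoding length of its operands; a constant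
  \<open>\<kappa>\<close> gives the unit-cost model. Every other elementary step takes one unit of time.
\<close>

record clock =
  elapsed :: nat
  slowest_call :: nat

type_synonym 'a timed = "(clock, 'a) state"

definition tick :: "nat \<Rightarrow> unit timed" where
  "tick n = State_Monad.update (\<lambda>s. s\<lparr>elapsed := elapsed s + n\<rparr>)"

definition subroutine :: "'a \<times> nat \<Rightarrow> 'a timed" where
  "subroutine r = do {tick (snd r); State_Monad.return (fst r)}"

definition oracle_call :: "'a \<times> nat \<Rightarrow> 'a timed" where
  "oracle_call r = do {
     State_Monad.update (\<lambda>s. s\<lparr>slowest_call := max (slowest_call s) (snd r)\<rparr>);
     subroutine r}"

definition arith :: "nat poly \<Rightarrow> (rat \<Rightarrow> rat \<Rightarrow> 'a) \<Rightarrow> rat \<Rightarrow> rat \<Rightarrow> 'a timed" where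
  "arith \<kappa> f x y = do {tick (1 + poly \<kappa> (rat_length x + rat_length y)); State_Monad.return (f x y)}"

primrec for_each :: "'x list \<Rightarrow> 's \<Rightarrow> ('x \<Rightarrow> 's \<Rightarrow> 's timed) \<Rightarrow> 's timed" where
  "for_each [] s f = do {tick 1; State_Monad.return s}"
| "for_each (x # xs) s f = do {tick 1; s' \<leftarrow> f x s; for_each xs s' f}"


section \<open>The Cell Algorithm\<close>

definition coordinates :: "'p::{finite, linorder} list" where
  "coordinates = sorted_list_of_set UNIV"

definition eval_affine ::
    "nat poly \<Rightarrow> rat \<Rightarrow> 'p::{finite, linorder} ratvec \<Rightarrow> 'p ratvec \<Rightarrow> rat timed" where
  "eval_affine \<kappa> a b \<mu> = for_each coordinates a
     (\<lambda>i s. do {x \<leftarrow> arith \<kappa> (*) (\<mu> $ i) (b $ i); arith \<kappa> (+) s x})"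

primrec insert_sorted :: "nat poly \<Rightarrow> rat \<times> 'e \<Rightarrow> (rat \<times> 'e) list \<Rightarrow> (rat \<times> 'e) list timed" where
  "insert_sorted \<kappa> x [] = do {tick 1; State_Monad.return [x]}"
| "insert_sorted \<kappa> x (y # ys) = do {
     le \<leftarrow> arith \<kappa> (\<le>) (fst x) (fst y);
     if le then State_Monad.return (x # y # ys)
     else do {zs \<leftarrow> insert_sorted \<kappa> x ys; State_Monad.return (y # zs)}}"

text \<open>
  The greedy algorithm for a minimum weight basis of the matroid without \<open>F\<close> at \<open>\<mu>\<close>, with
  insertion sort. Searching an element in \<open>F\<close> is charged \<open>1 + budget I\<close>.
\<close>

definition sort_remaining ::
    "nat poly \<Rightarrow> ('e, 'p::{finite, linorder}) interdiction \<Rightarrow> 'p ratvec \<Rightarrow> 'e set \<Rightarrow>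
     (rat \<times> 'e) list timed" where
  "sort_remaining \<kappa> I \<mu> F = for_each (elements I) []
     (\<lambda>e xs. do {
        tick (1 + budget I);
        if e \<in> F then State_Monad.return xs
        else do {
          x \<leftarrow> eval_affine \<kappa> (const_coeff I e) (lin_coeff I e) \<mu>;
          insert_sorted \<kappa> (x, e) xs}})"

definition greedy_basis ::
    "nat poly \<Rightarrow> (bool list \<Rightarrow> 'e set \<Rightarrow> bool \<times> nat) \<Rightarrow>
     ('e, 'p::{finite, linorder}) interdiction \<Rightarrow> 'p ratvec \<Rightarrow> 'e set \<Rightarrow> 'e list timed" where
  "greedy_basis \<kappa> ind I \<mu> F = do {
     xs \<leftarrow> sort_remaining \<kappa> I \<mu> F;
     for_each xs [] (\<lambda>(_, e) B. do {
       yes \<leftarrow> subroutine (ind (matroid_code I) (insert e (set B)));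
       State_Monad.return (if yes then e # B else B)})}"

lemma run_state_tick [simp]: "run_state (tick n) s = ((), s\<lparr>elapsed := elapsed s + n\<rparr>)"
  by (simp add: tick_def State_Monad.update_def)

lemma result_subroutine [simp]: "fst (run_state (subroutine r) s) = fst r"
  by (simp add: subroutine_def)

lemma result_arith [simp]: "fst (run_state (arith \<kappa> f x y) s) = f x y"
  by (simp add: arith_def)

lemma result_bind:
  "fst (run_state (m \<bind> f) s) = fst (run_state (f (fst (run_state m s))) (snd (run_state m s)))"
  by (simp add: case_prod_beta)

lemma result_for_each:
  assumes "\<And>x s clk. fst (run_state (f x s) clk) = g x s"
  shows "fst (run_state (for_each xs s f) clk) = fold g xs s"
proof (induction xs arbitrary: s clk)
  case (Cons x xs)
  show ?case
    by (simp add: case_prod_beta assms Cons.IH)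
qed simp

lemma result_eval_affine:
  fixes b \<mu> :: "'p::{finite, linorder} ratvec"
  shows "fst (run_state (eval_affine \<kappa> a b \<mu>) clk) = a + (\<Sum>i\<in>UNIV. \<mu> $ i * b $ i)"
proof -
  have fold: "fold (\<lambda>i s. s + \<mu> $ i * b $ i) is s = s + (\<Sum>i\<leftarrow>is. \<mu> $ i * b $ i)" for "is" s
    by (induction "is" arbitrary: s) (auto simp: algebra_simps)
  have "fst (run_state (eval_affine \<kappa> a b \<mu>) clk) = fold (\<lambda>i s. s + \<mu> $ i * b $ i) coordinates a"
    unfolding eval_affine_def by (rule result_for_each) (simp add: case_prod_beta)
  also have "\<dots> = a + (\<Sum>i\<leftarrow>coordinates. \<mu> $ i * b $ i)"
    by (rule fold)
  also have "(\<Sum>i\<leftarrow>coordinates. \<mu> $ i * b $ i) = (\<Sum>i\<in>UNIV. \<mu> $ i * b $ i)"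
    by (simp add: coordinates_def sum_list_distinct_conv_sum_set)
  finally show ?thesis .
qed

lemma result_insert_sorted:
  "fst (run_state (insert_sorted \<kappa> x ys) clk) = insort_key fst x ys"
  by (induction ys arbitrary: clk) (simp_all add: case_prod_beta)

definition rat_weight :: "('e, 'p::finite) interdiction \<Rightarrow> 'p ratvec \<Rightarrow> 'e \<Rightarrow> rat" where
  "rat_weight I \<mu> e = const_coeff I e + (\<Sum>i\<in>UNIV. \<mu> $ i * lin_coeff I e $ i)"

lemma of_rat_weight: "of_rat (rat_weight I \<mu> e) = weight I e (real_vec \<mu>)"
  by (simp add: rat_weight_def weight_def real_vec_def of_rat_add of_rat_sum of_rat_mult)

lemma result_sort_remaining:
  fixes I :: "('e, 'p::{finite, linorder}) interdiction" and F \<mu> \<kappa> clk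
  assumes "distinct (elements I)"
  defines "xs \<equiv> fst (run_state (sort_remaining \<kappa> I \<mu> F) clk)"
  shows "sorted (map fst xs)" "distinct xs"
    "set xs = (\<lambda>e. (rat_weight I \<mu> e, e)) ` (ground I - F)"
proof -
  let ?g = "\<lambda>e xs. if e \<in> F then xs else insort_key fst (rat_weight I \<mu> e, e) xs"
  have 1: "xs = fold ?g (elements I) []"
    unfolding xs_def sort_remaining_def
    by (rule result_for_each)
      (simp add: case_prod_beta result_insert_sorted result_eval_affine rat_weight_def)
  have 2: "sorted (map fst zs) \<Longrightarrow> sorted (map fst (fold ?g es zs))" for es and zs :: "(rat \<times> 'e) list"
    by (induction es arbitrary: zs) (auto simp: sorted_insort_key)
  have 3: "set (fold ?g es zs) = set zs \<union> (\<lambda>e. (rat_weight I \<mu> e, e)) ` (set es - F)"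
    for es and zs :: "(rat \<times> 'e) list"
    by (induction es arbitrary: zs) (auto simp: set_insort_key)
  have 4: "distinct zs \<Longrightarrow> distinct es \<Longrightarrow> snd ` set zs \<inter> set es = {} \<Longrightarrow> distinct (fold ?g es zs)"
    for es and zs :: "(rat \<times> 'e) list"
  proof (induction es arbitrary: zs)
    case (Cons e es)
    have "(rat_weight I \<mu> e, e) \<notin> set zs"
    proof
      assume "(rat_weight I \<mu> e, e) \<in> set zs"
      then have "e \<in> snd ` set zs" by (metis image_eqI snd_conv)
      with Cons.prems(3) show False by simp
    qed
    then have "distinct (?g e zs)"
      using Cons.prems(1) by (simp add: distinct_insort)
    moreover have "snd ` set (?g e zs) \<inter> set es = {}"
      using Cons.prems by (auto simp: set_insort_key)
    ultimately show ?case
      using Cons.IH[of "?g e zs"] Cons.prems by simp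
  qed simp
  show "sorted (map fst xs)" unfolding 1 by (rule 2) simp
  show "distinct xs" unfolding 1 using assms(1) by (intro 4) auto
  show "set xs = (\<lambda>e. (rat_weight I \<mu> e, e)) ` (ground I - F)"
    unfolding 1 3 by (simp add: ground_def)
qed

lemma matroidD:
  assumes "matroid E \<F>"
  shows "finite E" "X \<in> \<F> \<Longrightarrow> X \<subseteq> E" "{} \<in> \<F>" "X \<in> \<F> \<Longrightarrow> Y \<subseteq> X \<Longrightarrow> Y \<in> \<F>"
    "X \<in> \<F> \<Longrightarrow> Y \<in> \<F> \<Longrightarrow> card X < card Y \<Longrightarrow> \<exists>e\<in>Y - X. insert e X \<in> \<F>"
proof -
  note M = assms[unfolded matroid_def]
  show "finite E" by (rule M[THEN conjunct1])
  show "X \<in> \<F> \<Longrightarrow> X \<subseteq> E" using M[THEN conjunct2, THEN conjunct1] by (rule PowD[OF subsetD])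
  show "{} \<in> \<F>" by (rule M[THEN conjunct2, THEN conjunct2, THEN conjunct1])
  show "X \<in> \<F> \<Longrightarrow> Y \<subseteq> X \<Longrightarrow> Y \<in> \<F>"
    by (rule M[THEN conjunct2, THEN conjunct2, THEN conjunct2, THEN conjunct1, rule_format])
  show "X \<in> \<F> \<Longrightarrow> Y \<in> \<F> \<Longrightarrow> card X < card Y \<Longrightarrow> \<exists>e\<in>Y - X. insert e X \<in> \<F>"
    by (rule M[THEN conjunct2, THEN conjunct2, THEN conjunct2, THEN conjunct2, rule_format])
qed

lemma matroid_extend:
  assumes M: "matroid E \<F>" and "X \<in> \<F>" "Y \<in> \<F>" "card X \<le> card Y"
  shows "\<exists>Z\<in>\<F>. X \<subseteq> Z \<and> Z \<subseteq> X \<union> Y \<and> card Z = card Y"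
  using assms(2-4)
proof (induction "card Y - card X" arbitrary: X)
  case 0
  then show ?case by (intro bexI[of _ X]) auto
next
  case (Suc n)
  then have "card X < card Y" by linarith
  with Suc.prems(1,2) M have "\<exists>e\<in>Y - X. insert e X \<in> \<F>"
    by (intro matroidD(5))
  then obtain e where e: "e \<in> Y - X" "insert e X \<in> \<F>" by (elim bexE)
  have "finite X"
    by (rule finite_subset[OF matroidD(2)[OF M Suc.prems(1)] matroidD(1)[OF M]])
  with e have "card (insert e X) = Suc (card X)" by simp
  with Suc.hyps(2) \<open>card X < card Y\<close> have "n = card Y - card (insert e X)" "card (insert e X) \<le> card Y"
    by linarith+
  from Suc.hyps(1)[OF this(1) e(2) Suc.prems(2) this(2)] obtain Z
    where "Z \<in> \<F>" "insert e X \<subseteq> Z" "Z \<subseteq> insert e X \<union> Y" "card Z = card Y"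
    by (elim bexE conjE)
  with e(1) show ?case by (intro bexI[of _ Z]) auto
qed

text \<open>
  The sets computed by \<open>greedy_basis\<close> are minimum weight bases.
\<close>

lemma min_weight_basis_greedy_basis:
  fixes I :: "('e, 'p::{finite, linorder}) interdiction"
  assumes "distinct (elements I)" and M: "matroid (ground I) (indeps I)" and enc: "encodes_matroid ind I"
  shows "min_weight_basis I F (real_vec \<mu>) (set (fst (run_state (greedy_basis \<kappa> ind I \<mu> F) clk)))"
proof -
  let ?w = "\<lambda>e. weight I e (real_vec \<mu>)" and ?W = "\<lambda>B. set_weight I B (real_vec \<mu>)"
  define xs where "xs = fst (run_state (sort_remaining \<kappa> I \<mu> F) clk)"
  note xs = result_sort_remaining[OF assms(1), where \<kappa>=\<kappa> and \<mu>=\<mu> and F=F and clk=clk, folded xs_def]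
  define es where "es = map snd xs"
  have xs_es: "xs = map (\<lambda>e. (rat_weight I \<mu> e, e)) es"
  proof -
    have "map (\<lambda>e. (rat_weight I \<mu> e, e)) es = map (\<lambda>x. (rat_weight I \<mu> (snd x), snd x)) xs"
      by (simp add: es_def)
    also have "\<dots> = xs"
      using xs(3) by (intro map_idI) auto
    finally show ?thesis ..
  qed
  have es: "set es = ground I - F" "distinct es" "sorted_wrt (\<lambda>e f. ?w e \<le> ?w f) es"
  proof -
    show "set es = ground I - F" unfolding es_def using xs(3) by force
    show "distinct es" using xs(2) unfolding xs_es by (simp add: distinct_map)
    show "sorted_wrt (\<lambda>e f. ?w e \<le> ?w f) es"
      using xs(1) unfolding xs_es
      by (simp add: sorted_map comp_def of_rat_weight[symmetric] of_rat_less_eq)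
  qed
  let ?T = "\<lambda>e X. fst (ind (matroid_code I) (insert e (set X)))"
  have res: "fst (run_state (greedy_basis \<kappa> ind I \<mu> F) clk) =
      fold (\<lambda>e B. if ?T e B then e # B else B) es []"
  proof -
    have "fst (run_state (greedy_basis \<kappa> ind I \<mu> F) clk) =
        fold (\<lambda>x B. if ?T (snd x) B then snd x # B else B) xs []"
      unfolding greedy_basis_def result_bind xs_def
      by (rule result_for_each) (simp add: case_prod_beta)
    then show ?thesis unfolding xs_es by (simp add: fold_map comp_def cong: if_cong)
  qed
  have fin: "finite (ground I)" by (simp add: ground_def)
  have sub: "Y \<in> indeps I" if "X \<in> indeps I" "Y \<subseteq> X" for X Y
    by (rule matroidD(4)[OF M that])
  have ground: "X \<subseteq> ground I" if "X \<in> indeps I" for X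
    by (rule matroidD(2)[OF M that])
  have finX: "finite X" if "X \<in> indeps I" for X
    using ground[OF that] fin by (rule finite_subset)
  have bcard: "card X \<le> card B" if B: "basis_without I F B" and X: "X \<in> indeps I" "X \<subseteq> ground I - F" for B X
  proof (rule ccontr)
    assume "\<not> card X \<le> card B"
    then obtain e where "e \<in> X - B" "insert e B \<in> indeps I"
      using matroidD(5)[OF M, of B X] B X(1) by (auto simp: basis_without_def not_le)
    then show False using B X(2) unfolding basis_without_def by blast
  qed
  have basisI: "basis_without I F Z" if B: "basis_without I F B"
    and Z: "Z \<in> indeps I" "Z \<subseteq> ground I - F" "card Z = card B" for B Z
    unfolding basis_without_def
  proof (intro conjI ballI notI Z(1,2))
    fix e assume e: "e \<in> ground I - F - Z" "insert e Z \<in> indeps I"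
    have "card (insert e Z) \<le> card B"
      using e Z(2) by (intro bcard[OF B]) auto
    then show False using e Z finX[OF Z(1)] by simp
  qed
  have step: "min_weight_basis I F (real_vec \<mu>) (set (fold (\<lambda>e B. if ?T e B then e # B else B) fs B))"
    if "es = ds @ fs" "min_weight_basis I F (real_vec \<mu>) N" "N \<inter> set ds = set B" "set B \<subseteq> set ds"
    for ds fs B N
    using that
  proof (induction fs arbitrary: ds B N)
    case Nil
    then have "N = set B"
      using es(1) unfolding min_weight_basis_def basis_without_def by auto
    with Nil show ?case by simp
  next
    case (Cons e fs)
    note N = Cons.prems(2)
    have bN: "basis_without I F N" using N by (simp add: min_weight_basis_def)
    then have iN: "N \<in> indeps I" "N \<subseteq> ground I - F" by (auto simp: basis_without_def)
    have eg: "e \<in> ground I - F" using Cons.prems(1) es(1) by auto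
    have ed: "e \<notin> set ds" using Cons.prems(1) es(2) by auto
    have BN: "set B \<subseteq> N" using Cons.prems(3) by auto
    have "insert e (set B) \<subseteq> ground I" using BN iN eg by auto
    then have T: "?T e B \<longleftrightarrow> insert e (set B) \<in> indeps I"
      using enc by (simp add: encodes_matroid_def)
    show ?case
    proof (cases "?T e B")
      case False
      then have "e \<notin> N" using T BN sub[OF iN(1), of "insert e (set B)"] by blast
      then have "N \<inter> set (ds @ [e]) = set B" "set B \<subseteq> set (ds @ [e])" using Cons.prems(3,4) by auto
      from Cons.IH[OF _ N this] Cons.prems(1) False show ?thesis by simp
    next
      case True
      then have ind: "insert e (set B) \<in> indeps I" using T by simp
      have "\<exists>N'. min_weight_basis I F (real_vec \<mu>) N' \<and> N' \<inter> set (ds @ [e]) = insert e (set B)"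
      proof (cases "e \<in> N")
        case True
        then show ?thesis using N Cons.prems(3) ed by (intro exI[of _ N]) auto
      next
        case False
        have "insert e (set B) \<subseteq> ground I - F" using BN iN eg by auto
        from matroid_extend[OF M ind iN(1) bcard[OF bN ind this]]
        obtain Z where Z: "Z \<in> indeps I" "insert e (set B) \<subseteq> Z" "Z \<subseteq> insert e (set B) \<union> N"
          "card Z = card N" by (elim bexE conjE)
        have finN: "finite N" by (rule finX[OF iN(1)])
        have Zs: "Z \<subseteq> insert e N" using Z(3) BN by auto
        then have Zm: "Z - {e} \<subseteq> N" by auto
        have eZ: "e \<in> Z" using Z(2) by auto
        have "card (N - (Z - {e})) = 1"
        proof -
          have "card (N - (Z - {e})) = card N - card (Z - {e})"
            using finX[OF Z(1)] Zm by (intro card_Diff_subset) auto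
          moreover have "card Z = Suc (card (Z - {e}))"
            using finX[OF Z(1)] eZ by (rule card.remove)
          ultimately show ?thesis using Z(4) by simp
        qed
        then obtain f where f: "N - (Z - {e}) = {f}" by (elim card_1_singletonE)
        then have fN: "f \<in> N" "f \<notin> Z" using False by auto
        have Neq: "N = insert f (Z - {e})" using f Zm by auto
        have "f \<in> set es" using fN iN es(1) by auto
        moreover have "f \<notin> set ds" using fN Z(2) Cons.prems(3) by auto
        moreover have "f \<noteq> e" using fN False by auto
        ultimately have "f \<in> set fs" using Cons.prems(1) by auto
        then have wf: "?w e \<le> ?w f" using es(3) Cons.prems(1) by (auto simp: sorted_wrt_append)
        have "?W Z = ?w e + ?W (Z - {e})"
          unfolding set_weight_def using eZ finX[OF Z(1)] by (rule sum.remove[rotated])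
        moreover have "?W N = ?w f + ?W (Z - {e})"
          unfolding set_weight_def by (subst Neq) (use fN finX[OF Z(1)] in simp)
        ultimately have "?W Z \<le> ?W N" using wf by simp
        moreover have "basis_without I F Z"
          using Zs iN eg Z(1,4) by (intro basisI[OF bN]) auto
        ultimately have "min_weight_basis I F (real_vec \<mu>) Z"
          using N unfolding min_weight_basis_def by (meson order_trans)
        moreover have "Z \<inter> set (ds @ [e]) = insert e (set B)"
          using Z(2) Zs Cons.prems(3,4) ed by auto
        ultimately show ?thesis by blast
      qed
      then obtain N' where N': "min_weight_basis I F (real_vec \<mu>) N'"
        "N' \<inter> set (ds @ [e]) = set (e # B)" by auto
      have "set (e # B) \<subseteq> set (ds @ [e])" using Cons.prems(4) by auto
      from Cons.IH[OF _ N' this] Cons.prems(1) True show ?thesis by simp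
    qed
  qed
  define \<B> where "\<B> = {B. basis_without I F B}"
  have "finite \<B>"
    by (rule finite_subset[of _ "Pow (ground I)"]) (auto simp: \<B>_def basis_without_def fin)
  moreover have "\<B> \<noteq> {}"
  proof -
    define \<X> where "\<X> = {X \<in> indeps I. X \<subseteq> ground I - F}"
    have "finite \<X>"
      by (rule finite_subset[of _ "Pow (ground I)"]) (auto simp: \<X>_def fin)
    moreover have "{} \<in> \<X>"
      using matroidD(3)[OF M] by (simp add: \<X>_def)
    ultimately have "\<exists>X\<in>\<X>. \<forall>Y\<in>\<X>. X \<subseteq> Y \<longrightarrow> X = Y"
      by (intro finite_has_maximal) auto
    then obtain X where X: "X \<in> \<X>" "\<forall>Y\<in>\<X>. X \<subseteq> Y \<longrightarrow> X = Y" ..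
    have "insert e X \<notin> indeps I" if "e \<in> ground I - F - X" for e
      using X(1) X(2)[THEN bspec, of "insert e X"] that by (auto simp: \<X>_def)
    with X(1) have "basis_without I F X"
      by (auto simp: basis_without_def \<X>_def)
    then show ?thesis by (auto simp: \<B>_def)
  qed
  ultimately obtain N where "is_arg_min ?W (\<lambda>B. B \<in> \<B>) N"
    using ex_is_arg_min_if_finite by blast
  then have "min_weight_basis I F (real_vec \<mu>) N"
    by (simp add: \<B>_def min_weight_basis_def is_arg_min_linorder)
  from step[OF _ this, of "[]" es "[]"] show ?thesis unfolding res by simp
qed

definition basis_coeffs ::
    "nat poly \<Rightarrow> ('e, 'p::{finite, linorder}) interdiction \<Rightarrow> 'e list \<Rightarrow> (rat \<times> 'p ratvec) timed" where
  "basis_coeffs \<kappa> I B = do {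
     a \<leftarrow> for_each B 0 (\<lambda>e s. arith \<kappa> (+) s (const_coeff I e));
     b \<leftarrow> for_each coordinates 0 (\<lambda>i v. do {
       s \<leftarrow> for_each B 0 (\<lambda>e s. arith \<kappa> (+) s (lin_coeff I e $ i));
       State_Monad.return (\<chi> j. if j = i then s else v $ j)});
     State_Monad.return (a, b)}"

text \<open>
  The half-space \<open>\<phi>(F)\<close> of all \<open>(\<mu>, z)\<close> with \<open>a + b \<bullet> \<mu> \<le> z\<close>, where \<open>a + b \<bullet> \<mu>\<close> is the
  weight of the basis computed for \<open>F\<close>.
\<close>

definition phi :: "rat \<Rightarrow> 'p::finite ratvec \<Rightarrow> 'p halfspace" where
  "phi a b = ((b, -1), - a)"

definition cylinder :: "('p::finite ratvec \<times> rat) list \<Rightarrow> 'p halfspace list" where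
  "cylinder hs = map (\<lambda>(u, t). ((u, 0), t)) hs"

record ('e, 'p::finite) cell_state =
  found :: "'e set set"
  polyhedron_rep :: "'p halfspace list"
  unexamined :: "'p point list"

definition cell_init ::
    "nat poly \<Rightarrow> (bool list \<Rightarrow> 'e set \<Rightarrow> bool \<times> nat) \<Rightarrow>
     ('p halfspace list \<Rightarrow> 'p point list \<times> nat) \<Rightarrow> ('p ratvec \<Rightarrow> 'e set \<times> nat) \<Rightarrow>
     ('e, 'p::{finite, linorder}) interdiction \<Rightarrow> ('p ratvec \<times> rat) list \<Rightarrow> 'p ratvec \<Rightarrow>
     ('e, 'p) cell_state timed" where
  "cell_init \<kappa> ind enum orc I hs \<mu>\<^sub>0 = do {
     F \<leftarrow> oracle_call (orc \<mu>\<^sub>0);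
     B \<leftarrow> greedy_basis \<kappa> ind I \<mu>\<^sub>0 F;
     (a, b) \<leftarrow> basis_coeffs \<kappa> I B;
     tick (\<Sum>h\<leftarrow>cylinder hs. halfspace_length h);
     let A = phi a b # cylinder hs;
     vs \<leftarrow> subroutine (enum A);
     State_Monad.return \<lparr>found = {F}, polyhedron_rep = A, unexamined = vs\<rparr>}"

text \<open>
  The test \<open>(1 - \<epsilon>) * v > z\<close> is charged by the encoding lengths of \<open>v\<close> and \<open>z\<close>, since
  \<open>\<epsilon>\<close> is not a part of the instance and may be any real number.
\<close>

definition examine_vertex ::
    "nat poly \<Rightarrow> (bool list \<Rightarrow> 'e set \<Rightarrow> bool \<times> nat) \<Rightarrow>
     ('p halfspace list \<Rightarrow> 'p point list \<times> nat) \<Rightarrow> ('p ratvec \<Rightarrow> 'e set \<times> nat) \<Rightarrow> real \<Rightarrow>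
     ('e, 'p::{finite, linorder}) interdiction \<Rightarrow> 'p ratvec \<Rightarrow>
     ('e, 'p) cell_state \<Rightarrow> ('e, 'p) cell_state timed" where
  "examine_vertex \<kappa> ind enum orc \<epsilon> I \<mu>\<^sub>0 st = do {
     let (\<mu>, z) = hd (unexamined st);
     F \<leftarrow> oracle_call (orc \<mu>);
     B \<leftarrow> greedy_basis \<kappa> ind I \<mu>\<^sub>0 F;
     (a, b) \<leftarrow> basis_coeffs \<kappa> I B;
     v \<leftarrow> eval_affine \<kappa> a b \<mu>;
     violated \<leftarrow> arith \<kappa> (\<lambda>v z. (1 - \<epsilon>) * of_rat v > of_rat z) v z;
     if violated then do {
       let A = phi a b # polyhedron_rep st;
       vs \<leftarrow> subroutine (enum A);
       State_Monad.return \<lparr>found = insert F (found st), polyhedron_rep = A, unexamined = vs\<rparr>}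
     else State_Monad.return (st\<lparr>unexamined := tl (unexamined st)\<rparr>)}"

text \<open>
  The result is \<open>None\<close> iff the algorithm does not terminate.
\<close>

definition cell_algorithm ::
    "nat poly \<Rightarrow> (bool list \<Rightarrow> 'e set \<Rightarrow> bool \<times> nat) \<Rightarrow>
     (('e, 'p::{finite, linorder}) interdiction \<Rightarrow> ('p ratvec \<times> rat) list \<Rightarrow> 'p ratvec \<times> nat) \<Rightarrow>
     ('p halfspace list \<Rightarrow> 'p point list \<times> nat) \<Rightarrow> ('p ratvec \<Rightarrow> 'e set \<times> nat) \<Rightarrow>
     ('e, 'p) interdiction \<Rightarrow> real \<Rightarrow> ('p ratvec \<times> rat) list \<Rightarrow> ('e set set \<times> clock) option" where
  "cell_algorithm \<kappa> ind pick enum orc I \<epsilon> hs =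
     (let (\<mu>\<^sub>0, clk) = run_state (subroutine (pick I hs)) \<lparr>elapsed = 0, slowest_call = 0\<rparr>
      in map_option (\<lambda>(st, clk). (found st, clk))
           (while_option
              (\<lambda>(st, clk). unexamined st \<noteq> [])
              (\<lambda>(st, clk). run_state (examine_vertex \<kappa> ind enum orc \<epsilon> I \<mu>\<^sub>0 st) clk)
              (run_state (cell_init \<kappa> ind enum orc I hs \<mu>\<^sub>0) clk)))"

text \<open>
  A polynomial in three variables is a polynomial over polynomials over polynomials.
\<close>

definition poly3 :: "real poly poly poly \<Rightarrow> real \<Rightarrow> real \<Rightarrow> real \<Rightarrow> real" where
  "poly3 P x y z = poly (poly (poly P [:[:x:]:]) [:y:]) z"

end

theory Submission
  imports Defs
begin

text \<open>
  The weight of a basis is an affine function \<open>a + b \<bullet> \<mu>\<close> of the parameters whose coefficients are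
  sums of input coefficients. The coefficients are therefore non-negative, and those that are not
  \<open>0\<close> lie between \<open>2 ^ (- K)\<close> and \<open>2 ^ K\<close> for a \<open>K\<close> that is polynomial in the encoding length. Put
  a grid on the positive reals whose consecutive points have ratio \<open>exp \<epsilon>\<close>. Only \<open>O(K / \<epsilon>)\<close> of its
  intervals are met by coefficients, so that the vectors \<open>(a, b)\<close> lie in at most \<open>O(K / \<epsilon>) ^
  (p+1)\<close> grid cells (\<open>length_le_grid_size\<close>), which is polynomial for a fixed number \<open>p\<close> of
  parameters.

  Parameters are non-negative as well, so coefficientwise comparison carries over to values: at
  every parameter the values of two functions of the same grid cell differ by a factor of at most
  \<open>exp \<epsilon>\<close>, and \<open>exp (- \<epsilon>) \<ge> 1 - \<epsilon>\<close> (\<open>affine_value_grid_cell\<close>). At a vertex \<open>(\<mu>, z)\<close> of the current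
  polyhedron all functions found earlier have values at most \<open>z\<close>. A restart happens only if the
  new function has a value above \<open>z / (1 - \<epsilon>)\<close>. Hence the new function lies in a grid cell that
  was not visited before (\<open>violated_new_grid_cell\<close>), and the number of restarts is at most the
  number of grid cells.

  Consequently all polyhedra have polynomially many facets of polynomial encoding length. Since
  the dimension is fixed, the vertex enumeration then yields polynomially many vertices with
  coordinates of polynomial length, in polynomial time. Each vertex costs one oracle call, one run
  of the greedy algorithm and some arithmetic with short numbers. A potential function, composed
  of the number of grid cells still available and the number of vertices still to be examined,
  drops in each step; this gives both termination and the time bound (\<open>loop_terminates\<close>).
\<close>

section \<open>Bit lengths of fractions\<close>

text \<open>
  The fraction need not be in lowest terms. Bounding numerator and denominator by the same power
  makes the bound additive, up to \<open>1\<close>, under both sums and products. The total length of numerator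
  and denominator does not have this property: a sum counts both denominators twice, and the
  estimate would grow exponentially in the number of summands.
\<close>

definition frac_bits :: "nat \<Rightarrow> rat \<Rightarrow> bool" where
  "frac_bits k x \<longleftrightarrow> (\<exists>n d :: int. x = of_int n / of_int d \<and> 0 < d \<and> \<bar>n\<bar> \<le> 2 ^ k \<and> d \<le> 2 ^ k)"

lemma frac_bits_mono:
  assumes "frac_bits k x" "k \<le> l"
  shows "frac_bits l x"
proof -
  have le: "(2::int) ^ k \<le> 2 ^ l" using assms(2) by (simp add: power_increasing)
  obtain n d where x: "x = of_int n / of_int d" "0 < d" "\<bar>n\<bar> \<le> 2 ^ k" "d \<le> 2 ^ k"
    using assms(1) unfolding frac_bits_def by blast
  show ?thesis
    unfolding frac_bits_def
    by (intro exI[of _ n] exI[of _ d] conjI x(1,2) order_trans[OF x(3) le] order_trans[OF x(4) le])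
qed

lemma frac_bits_0: "frac_bits k 0"
  unfolding frac_bits_def by (intro exI[of _ 0] exI[of _ 1]) simp

lemma frac_bits_add:
  assumes "frac_bits k x" "frac_bits l y"
  shows "frac_bits (k + l + 1) (x + y)"
proof -
  obtain n d where x: "x = of_int n / of_int d" "0 < d" "\<bar>n\<bar> \<le> 2 ^ k" "d \<le> 2 ^ k"
    using assms(1) unfolding frac_bits_def by blast
  obtain m e where y: "y = of_int m / of_int e" "0 < e" "\<bar>m\<bar> \<le> 2 ^ l" "e \<le> 2 ^ l"
    using assms(2) unfolding frac_bits_def by blast
  have "x + y = of_int (n * e + m * d) / of_int (d * e)"
    using x(1,2) y(1,2) by (simp add: field_simps)
  moreover have "0 < d * e" using x(2) y(2) by simp
  moreover have "\<bar>n * e + m * d\<bar> \<le> 2 ^ (k + l + 1)"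
  proof -
    have "\<bar>n * e\<bar> \<le> 2 ^ k * 2 ^ l" "\<bar>m * d\<bar> \<le> 2 ^ l * 2 ^ k"
      using x y by (auto simp: abs_mult intro!: mult_mono)
    then have "\<bar>n * e + m * d\<bar> \<le> 2 * (2 ^ k * 2 ^ l)"
      using abs_triangle_ineq[of "n * e" "m * d"] by (simp add: mult.commute[of "2 ^ l"])
    then show ?thesis by (simp add: power_add)
  qed
  moreover have "d * e \<le> 2 ^ (k + l + 1)"
  proof -
    have "d * e \<le> 2 ^ k * 2 ^ l" using x y by (intro mult_mono) auto
    also have "\<dots> \<le> 2 ^ (k + l + 1)" by (simp add: power_add)
    finally show ?thesis .
  qed
  ultimately show ?thesis unfolding frac_bits_def by blast
qed

lemma frac_bits_mult:
  assumes "frac_bits k x" "frac_bits l y"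
  shows "frac_bits (k + l) (x * y)"
proof -
  obtain n d where x: "x = of_int n / of_int d" "0 < d" "\<bar>n\<bar> \<le> 2 ^ k" "d \<le> 2 ^ k"
    using assms(1) unfolding frac_bits_def by blast
  obtain m e where y: "y = of_int m / of_int e" "0 < e" "\<bar>m\<bar> \<le> 2 ^ l" "e \<le> 2 ^ l"
    using assms(2) unfolding frac_bits_def by blast
  have "x * y = of_int (n * m) / of_int (d * e)" "0 < d * e"
    using x(1,2) y(1,2) by simp_all
  moreover have "\<bar>n * m\<bar> \<le> 2 ^ (k + l)" "d * e \<le> 2 ^ (k + l)"
    using x y unfolding abs_mult power_add by (auto intro!: mult_mono)
  ultimately show ?thesis unfolding frac_bits_def by blast
qed

lemma frac_bits_uminus: "frac_bits k x \<Longrightarrow> frac_bits k (- x)"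
  unfolding frac_bits_def by (metis abs_minus_cancel minus_divide_left of_int_minus)

lemma frac_bits_diff:
  assumes "frac_bits k x" "frac_bits l y"
  shows "frac_bits (k + l + 1) (x - y)"
  using frac_bits_add[OF assms(1) frac_bits_uminus[OF assms(2)]] by simp

lemma abs_le_power_int_length: "\<bar>z\<bar> \<le> 2 ^ int_length z"
proof -
  have "\<bar>z\<bar> < 2 ^ nat (bitlen \<bar>z\<bar>)"
    using bitlen_le_iff_power[of "\<bar>z\<bar>" "bitlen \<bar>z\<bar>"] by simp
  then show ?thesis by (simp add: int_length_def)
qed

lemma int_length_le:
  assumes "\<bar>z\<bar> \<le> 2 ^ k"
  shows "int_length z \<le> k + 2"
proof -
  have "\<bar>z\<bar> < 2 ^ (k + 1)" using assms by (rule le_less_trans) simp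
  then have "\<bar>z\<bar> < 2 ^ nat (int (k + 1))" by (simp only: nat_int)
  then have "bitlen \<bar>z\<bar> \<le> int (k + 1)"
    unfolding bitlen_le_iff_power by simp
  then show ?thesis by (simp add: int_length_def)
qed

lemma frac_bits_if_rat_length_le:
  assumes "rat_length x \<le> k"
  shows "frac_bits k x"
proof -
  obtain n d where q: "quotient_of x = (n, d)" by force
  then have len: "int_length n + int_length d \<le> k" using assms by (simp add: rat_length_def)
  have le: "(2::int) ^ int_length n \<le> 2 ^ k" "(2::int) ^ int_length d \<le> 2 ^ k"
    using len by (simp_all add: power_increasing)
  have "\<bar>n\<bar> \<le> 2 ^ k" "d \<le> 2 ^ k"
    using order_trans[OF abs_le_power_int_length le(1)]
      order_trans[OF order_trans[OF abs_ge_self abs_le_power_int_length] le(2)] .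
  then show ?thesis
    unfolding frac_bits_def using quotient_of_div[OF q] quotient_of_denom_pos[OF q] by blast
qed

text \<open>
  Cancelling makes numerator and denominator only smaller. The summand \<open>4\<close> consists of a sign bit
  and one bit for the case \<open>\<bar>n\<bar> = 2 ^ k\<close>, for each of the two numbers.
\<close>

lemma rat_length_le_if_frac_bits:
  assumes "frac_bits k x"
  shows "rat_length x \<le> 2 * k + 4"
proof -
  obtain n d where x: "x = of_int n / of_int d" "0 < d" "\<bar>n\<bar> \<le> 2 ^ k" "d \<le> 2 ^ k"
    using assms unfolding frac_bits_def by blast
  obtain p q where pq: "quotient_of x = (p, q)" by force
  then have "(p, q) = Rat.normalize (n, d)"
    using x(1) by (simp add: Fract_of_int_quotient[symmetric] quotient_of_Fract)
  then have p: "p = n div gcd n d" and q: "q = d div gcd n d"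
    using x(2) by (simp_all add: normalize_def Let_def)
  have "0 < gcd n d" using x(2) by simp
  have le: "\<bar>r div gcd n d\<bar> \<le> \<bar>r\<bar>" if "gcd n d dvd r" for r
  proof -
    have "\<bar>r\<bar> = \<bar>r div gcd n d\<bar> * gcd n d"
      using that by (metis abs_gcd_int abs_mult dvd_div_mult_self)
    moreover have "\<bar>r div gcd n d\<bar> * 1 \<le> \<bar>r div gcd n d\<bar> * gcd n d"
      using \<open>0 < gcd n d\<close> by (intro mult_left_mono) linarith+
    ultimately show ?thesis by simp
  qed
  have "\<bar>p\<bar> \<le> \<bar>n\<bar>" unfolding p by (rule le) simp
  moreover have "\<bar>q\<bar> \<le> d" unfolding q using le[of d] x(2) by simp
  ultimately have "\<bar>p\<bar> \<le> 2 ^ k" "\<bar>q\<bar> \<le> 2 ^ k"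
    using x(3,4) by linarith+
  then have "int_length p \<le> k + 2" "int_length q \<le> k + 2"
    by (simp_all only: int_length_le)
  then show ?thesis by (simp add: rat_length_def pq)
qed

text \<open>
  A positive fraction with \<open>k\<close> bits lies between \<open>2 ^ (- k)\<close> and \<open>2 ^ k\<close>; the factor \<open>ln 2\<close> is at
  most \<open>1\<close>.
\<close>

lemma abs_ln_le_if_frac_bits:
  assumes "frac_bits k x" "0 < x"
  shows "\<bar>ln (of_rat x :: real)\<bar> \<le> real k"
proof -
  obtain n d where x: "x = of_int n / of_int d" "0 < d" "\<bar>n\<bar> \<le> 2 ^ k" "d \<le> 2 ^ k"
    using assms(1) unfolding frac_bits_def by blast
  have n: "0 < n" using assms(2) x(1,2) by (simp add: zero_less_divide_iff)
  have ln2: "ln (2::real) \<le> 1" using ln_2_less_1 by simp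
  have bd: "0 \<le> ln (real_of_int z) \<and> ln (real_of_int z) \<le> real k" if "0 < z" "z \<le> 2 ^ k" for z
  proof
    show "0 \<le> ln (real_of_int z)" using that by (intro ln_ge_zero) simp
    have "real_of_int z \<le> 2 ^ k" using that(2) by (metis of_int_le_iff of_int_numeral of_int_power)
    then have "ln (real_of_int z) \<le> ln (2 ^ k)" using that(1) by (intro ln_mono) auto
    also have "\<dots> = real k * ln 2" by (simp add: ln_realpow)
    also have "\<dots> \<le> real k * 1" using ln2 by (intro mult_left_mono) auto
    finally show "ln (real_of_int z) \<le> real k" by simp
  qed
  have "ln (of_rat x :: real) = ln (real_of_int n) - ln (real_of_int d)"
    using n x(2) by (simp add: x(1) of_rat_divide ln_div)
  moreover have "n \<le> 2 ^ k" using x(3) by simp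
  ultimately show ?thesis
    using bd[OF n \<open>n \<le> 2 ^ k\<close>] bd[OF x(2) x(4)] by linarith
qed

section \<open>Time bounds for timed programs\<close>

text \<open>
  A Hoare triple with a time bound and without precondition. It is meant for the code between two
  oracle calls and therefore keeps the record of the slowest call.
\<close>

definition runs :: "'a timed \<Rightarrow> nat \<Rightarrow> ('a \<Rightarrow> bool) \<Rightarrow> bool" where
  "runs m T Q \<longleftrightarrow> (\<forall>clk. elapsed (snd (run_state m clk)) \<le> elapsed clk + T \<and>
     slowest_call (snd (run_state m clk)) = slowest_call clk \<and> Q (fst (run_state m clk)))"

lemma runs_mono:
  assumes "runs m T Q" "T \<le> T'" "\<And>x. Q x \<Longrightarrow> Q' x"
  shows "runs m T' Q'"
  using assms unfolding runs_def by (meson add_left_mono order_trans)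

lemma runs_return: "Q x \<Longrightarrow> runs (State_Monad.return x) 0 Q"
  by (simp add: runs_def)

lemma runs_tick: "runs (tick n) n (\<lambda>_. True)"
  by (simp add: runs_def)

lemma runs_bind:
  assumes "runs m T Q" "\<And>x. Q x \<Longrightarrow> runs (f x) T' Q'"
  shows "runs (m \<bind> f) (T + T') Q'"
  unfolding runs_def
proof (intro allI)
  fix clk
  let ?x = "fst (run_state m clk)" and ?c = "snd (run_state m clk)"
  have eq: "run_state (m \<bind> f) clk = run_state (f ?x) ?c" by (simp add: case_prod_beta)
  have 1: "elapsed ?c \<le> elapsed clk + T \<and> slowest_call ?c = slowest_call clk \<and> Q ?x"
    using assms(1) by (auto simp: runs_def)
  with assms(2)[of ?x] have "elapsed (snd (run_state (f ?x) ?c)) \<le> elapsed ?c + T' \<and>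
      slowest_call (snd (run_state (f ?x) ?c)) = slowest_call ?c \<and> Q' (fst (run_state (f ?x) ?c))"
    by (auto simp: runs_def)
  with 1 show "elapsed (snd (run_state (m \<bind> f) clk)) \<le> elapsed clk + (T + T') \<and>
      slowest_call (snd (run_state (m \<bind> f) clk)) = slowest_call clk \<and>
      Q' (fst (run_state (m \<bind> f) clk))"
    unfolding eq by linarith
qed

lemma runs_subroutine:
  assumes "snd r \<le> T" "Q (fst r)"
  shows "runs (subroutine r) T Q"
  using assms by (simp add: runs_def subroutine_def case_prod_beta)

text \<open>
  The invariant depends on the number of iterations done so far, because the lengths of partial
  sums grow with it.
\<close>

lemma runs_for_each:
  assumes "length xs \<le> n"
    and "\<And>j x s. j < length xs \<Longrightarrow> x \<in> set xs \<Longrightarrow> Inv j s \<Longrightarrow> runs (f x s) T (Inv (Suc j))"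
    and "Inv 0 s"
  shows "runs (for_each xs s f) (n * (T + 1) + 1) (Inv (length xs))"
proof -
  have "runs (for_each xs s f) (length xs * (T + 1) + 1) (Inv (length xs))"
    using assms(2,3)
  proof (induction xs arbitrary: s Inv)
    case Nil
    then show ?case by (simp add: runs_def)
  next
    case (Cons x xs)
    have "runs (for_each xs s' f) (length xs * (T + 1) + 1) (Inv (length (x # xs)))" if "Inv 1 s'" for s'
      using Cons.IH[of "\<lambda>j. Inv (Suc j)" s'] Cons.prems(1) that by simp
    with Cons.prems(1)[of 0 x s] Cons.prems(2)
    have "runs (f x s \<bind> (\<lambda>s'. for_each xs s' f)) (T + (length xs * (T + 1) + 1))
        (Inv (length (x # xs)))"
      by (intro runs_bind[where Q = "Inv 1"]) auto
    then have "runs (for_each (x # xs) s f) (1 + (T + (length xs * (T + 1) + 1))) (Inv (length (x # xs)))"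
      unfolding for_each.simps by (intro runs_bind[OF runs_tick])
    then show ?case by (rule runs_mono) auto
  qed
  then show ?thesis
    by (rule runs_mono) (use assms(1) in \<open>auto simp del: mult_Suc_right intro: mult_le_mono1\<close>)
qed

text \<open>
  The cost of one operation on two numbers satisfying \<open>frac_bits k\<close>, each of which has an encoding
  length of at most \<open>2 * k + 4\<close>.
\<close>

definition op_time :: "nat poly \<Rightarrow> nat \<Rightarrow> nat" where
  "op_time \<kappa> k = 1 + poly \<kappa> (2 * (2 * k + 4))"

lemma poly_nat_mono: "x \<le> y \<Longrightarrow> poly (p :: nat poly) x \<le> poly p y"
  by (induction p) (auto intro!: add_mono mult_mono)

lemma runs_arith:
  assumes "frac_bits k x" "frac_bits k y" "Q (f x y)"
  shows "runs (arith \<kappa> f x y) (op_time \<kappa> k) Q"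
proof -
  have "rat_length x + rat_length y \<le> 2 * (2 * k + 4)"
    using rat_length_le_if_frac_bits[OF assms(1)] rat_length_le_if_frac_bits[OF assms(2)] by simp
  then have "1 + poly \<kappa> (rat_length x + rat_length y) \<le> op_time \<kappa> k"
    unfolding op_time_def by (intro add_left_mono poly_nat_mono)
  then show ?thesis using assms(3) by (simp add: runs_def arith_def)
qed

lemma coordinates_facts: "length (coordinates :: 'p::{finite, linorder} list) = CARD('p)"
  "set (coordinates :: 'p list) = UNIV" "distinct (coordinates :: 'p list)"
  by (simp_all add: coordinates_def)

lemma runs_result:
  assumes "runs m T Q" "\<And>clk. Q' (fst (run_state m clk))"
  shows "runs m T (\<lambda>x. Q x \<and> Q' x)"
  using assms by (simp add: runs_def)

section \<open>The greedy algorithm and the coefficients of a basis\<close>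

text \<open>
  Evaluating an affine function in \<open>p\<close> variables starts with a constant of \<open>S\<close> bits and adds \<open>p\<close>
  products of \<open>2 * S\<close> bits, each addition costing one more bit.
\<close>

definition affine_bits :: "nat \<Rightarrow> nat \<Rightarrow> nat" where
  "affine_bits p S = (p + 1) * (2 * S + 1)"

definition affine_time :: "nat poly \<Rightarrow> nat \<Rightarrow> nat \<Rightarrow> nat" where
  "affine_time \<kappa> p S = p * (2 * op_time \<kappa> (affine_bits p S) + 1) + 1"

lemma runs_eval_affine:
  fixes b \<mu> :: "'p::{finite, linorder} ratvec"
  assumes "frac_bits S a" "\<And>i. frac_bits S (b $ i)" "\<And>i. frac_bits S (\<mu> $ i)"
  shows "runs (eval_affine \<kappa> a b \<mu>) (affine_time \<kappa> CARD('p) S)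
    (\<lambda>v. frac_bits (affine_bits CARD('p) S) v \<and> v = a + (\<Sum>i\<in>UNIV. \<mu> $ i * b $ i))"
proof (rule runs_result)
  let ?W = "affine_bits CARD('p) S" and ?k = "\<lambda>j. S + j * (2 * S + 1)"
  have k: "?k j \<le> ?W" if "j \<le> CARD('p)" for j
  proof -
    have "j * (2 * S + 1) \<le> CARD('p) * (2 * S + 1)" using that by (rule mult_le_mono1)
    then show ?thesis unfolding affine_bits_def distrib_right by simp
  qed
  have step: "runs (arith \<kappa> (*) (\<mu> $ i) (b $ i) \<bind> arith \<kappa> (+) s)
      (2 * op_time \<kappa> ?W) (frac_bits (?k (Suc j)))"
    if j: "j < length (coordinates :: 'p list)" and s: "frac_bits (?k j) s" for i j s
  proof -
    have jp: "Suc j \<le> CARD('p)" using j by (simp add: coordinates_facts)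
    then have "S \<le> ?W" "S + S \<le> ?W" "?k j \<le> ?W"
      using k[of 0] k[of 1] k[of j] by simp_all
    then have S: "frac_bits ?W x" if "frac_bits S x \<or> frac_bits (S + S) x \<or> frac_bits (?k j) x" for x
      using that frac_bits_mono by blast
    have "runs (arith \<kappa> (+) s x) (op_time \<kappa> ?W) (frac_bits (?k (Suc j)))" if "frac_bits (S + S) x" for x
    proof (rule runs_arith)
      show "frac_bits (?k (Suc j)) (s + x)"
        using frac_bits_add[OF s that] by (rule frac_bits_mono) simp
    qed (use s that S in blast)+
    moreover have "runs (arith \<kappa> (*) (\<mu> $ i) (b $ i)) (op_time \<kappa> ?W) (frac_bits (S + S))"
      by (intro runs_arith frac_bits_mult assms S) (use assms in blast)+
    ultimately have "runs (arith \<kappa> (*) (\<mu> $ i) (b $ i) \<bind> arith \<kappa> (+) s)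
        (op_time \<kappa> ?W + op_time \<kappa> ?W) (frac_bits (?k (Suc j)))"
      by (intro runs_bind)
    then show ?thesis by (simp add: mult_2)
  qed
  have "runs (eval_affine \<kappa> a b \<mu>)
      (CARD('p) * (2 * op_time \<kappa> ?W + 1) + 1)
      (frac_bits (?k (length (coordinates :: 'p list))))"
    unfolding eval_affine_def
    by (rule runs_for_each[where Inv = "\<lambda>j. frac_bits (?k j)"])
      (use assms(1) step in \<open>simp_all add: coordinates_facts\<close>)
  then show "runs (eval_affine \<kappa> a b \<mu>) (affine_time \<kappa> CARD('p) S) (frac_bits ?W)"
    unfolding affine_time_def
    by (rule runs_mono) (use k[of "CARD('p)"] in \<open>auto simp: coordinates_facts elim: frac_bits_mono\<close>)
qed (rule result_eval_affine)

lemma runs_insert_sorted: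
  assumes "\<And>y. y \<in> insert x (set ys) \<Longrightarrow> frac_bits W (fst y)"
  shows "runs (insert_sorted \<kappa> x ys) (length ys * op_time \<kappa> W + 1)
    (\<lambda>zs. length zs = Suc (length ys) \<and> set zs = insert x (set ys))"
proof -
  have "runs (insert_sorted \<kappa> x ys) (length ys * op_time \<kappa> W + 1) (\<lambda>_. True)"
    using assms
  proof (induction ys)
    case Nil
    then show ?case by (simp add: runs_def)
  next
    case (Cons y ys)
    have "runs (insert_sorted \<kappa> x (y # ys)) (op_time \<kappa> W + (length ys * op_time \<kappa> W + 1)) (\<lambda>_. True)"
      unfolding insert_sorted.simps
    proof (rule runs_bind)
      show "runs (arith \<kappa> (\<le>) (fst x) (fst y)) (op_time \<kappa> W) (\<lambda>_. True)"
        by (intro runs_arith Cons.prems) auto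
    next
      fix le :: bool
      have "runs (insert_sorted \<kappa> x ys \<bind> (\<lambda>zs. State_Monad.return (y # zs)))
          (length ys * op_time \<kappa> W + 1 + 0) (\<lambda>_. True)"
        using Cons.prems by (intro runs_bind[OF Cons.IH] runs_return) auto
      moreover have "runs (State_Monad.return (x # y # ys)) (length ys * op_time \<kappa> W + 1) (\<lambda>_. True)"
        by (rule runs_mono[OF runs_return]) auto
      ultimately show "runs (if le then State_Monad.return (x # y # ys)
          else insert_sorted \<kappa> x ys \<bind> (\<lambda>zs. State_Monad.return (y # zs)))
          (length ys * op_time \<kappa> W + 1) (\<lambda>_. True)"
        by simp
    qed
    then show ?case by (rule runs_mono) auto
  qed
  from runs_result[OF this, of "\<lambda>zs. length zs = Suc (length ys) \<and> set zs = insert x (set ys)"]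
  show ?thesis by (simp add: result_insert_sorted set_insort_key)
qed

text \<open>
  A single number \<open>n\<close> bounds all sizes of an instance that influence the running time of the
  greedy algorithm.
\<close>

definition small_instance :: "nat \<Rightarrow> ('e, 'p::finite) interdiction \<Rightarrow> bool" where
  "small_instance n I \<longleftrightarrow> length (elements I) \<le> n \<and> budget I \<le> n \<and> length (matroid_code I) \<le> n \<and>
     (\<forall>e\<in>ground I. frac_bits n (const_coeff I e) \<and> (\<forall>i. frac_bits n (lin_coeff I e $ i)))"

text \<open>
  The first line is the time for sorting: each element is searched in \<open>F\<close>, evaluated and inserted.
  The second line is the time of at most \<open>n\<close> independence tests, of sets with at most \<open>n\<close> elements
  and a code of length at most \<open>n\<close>.
\<close>

definition greedy_time :: "nat poly \<Rightarrow> nat poly \<Rightarrow> nat \<Rightarrow> nat \<Rightarrow> nat \<Rightarrow> nat" where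
  "greedy_time \<kappa> Q p n S =
     n * (1 + n + (affine_time \<kappa> p S + (n * op_time \<kappa> (affine_bits p S) + 1)) + 1) + 1 +
     (n * (poly Q (n + n) + 1) + 1)"

lemma runs_sort_remaining:
  fixes I :: "('e, 'p::{finite, linorder}) interdiction"
  assumes I: "small_instance n I" and "n \<le> S" and \<mu>: "\<And>i. frac_bits S (\<mu> $ i)"
  shows "runs (sort_remaining \<kappa> I \<mu> F)
    (n * (1 + n + (affine_time \<kappa> CARD('p) S + (n * op_time \<kappa> (affine_bits CARD('p) S) + 1)) + 1) + 1)
    (\<lambda>xs. length xs \<le> n \<and> snd ` set xs \<subseteq> ground I)"
proof -
  let ?W = "affine_bits CARD('p) S" and ?T = "affine_time \<kappa> CARD('p) S"
  define Inv where "Inv j xs \<longleftrightarrow> length xs \<le> j \<and> (\<forall>x\<in>set xs. frac_bits ?W (fst x) \<and> snd x \<in> ground I)"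
    for j :: nat and xs :: "(rat \<times> 'e) list"
  have n: "length (elements I) \<le> n" "budget I \<le> n" using I by (auto simp: small_instance_def)
  have "runs (sort_remaining \<kappa> I \<mu> F)
      (n * (1 + n + (?T + (n * op_time \<kappa> ?W + 1)) + 1) + 1)
      (Inv (length (elements I)))"
    unfolding sort_remaining_def
  proof (rule runs_for_each)
    show "length (elements I) \<le> n" "Inv 0 []" using n by (simp_all add: Inv_def)
  next
    fix j e and xs :: "(rat \<times> 'e) list"
    assume j: "j < length (elements I)" and e: "e \<in> set (elements I)" and xs: "Inv j xs"
    have eg: "e \<in> ground I" using e by (simp add: ground_def)
    have coeffs: "frac_bits S (const_coeff I e)" "\<And>i. frac_bits S (lin_coeff I e $ i)"
      using I eg \<open>n \<le> S\<close> by (auto simp: small_instance_def intro: frac_bits_mono)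
    have "runs (eval_affine \<kappa> (const_coeff I e) (lin_coeff I e) \<mu> \<bind> (\<lambda>x. insert_sorted \<kappa> (x, e) xs))
        (?T + (n * op_time \<kappa> ?W + 1)) (Inv (Suc j))"
    proof (rule runs_bind[OF runs_eval_affine[OF coeffs \<mu>]])
      fix x assume x: "frac_bits ?W x \<and> x = const_coeff I e + (\<Sum>i\<in>UNIV. \<mu> $ i * lin_coeff I e $ i)"
      have "length xs \<le> n" using xs j n by (simp add: Inv_def)
      then have "length xs * op_time \<kappa> ?W + 1 \<le> n * op_time \<kappa> ?W + 1" by simp
      with runs_insert_sorted[of "(x, e)" xs ?W \<kappa>]
      show "runs (insert_sorted \<kappa> (x, e) xs) (n * op_time \<kappa> ?W + 1) (Inv (Suc j))"
        by (rule runs_mono) (use x xs eg in \<open>auto simp: Inv_def\<close>)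
    qed
    moreover have "Inv (Suc j) xs" using xs by (simp add: Inv_def)
    then have "runs (State_Monad.return xs) (?T + (n * op_time \<kappa> ?W + 1)) (Inv (Suc j))"
      by (intro runs_mono[OF runs_return]) auto
    moreover have "runs (tick (1 + budget I)) (1 + n) (\<lambda>_. True)"
      by (rule runs_mono[OF runs_tick]) (use n in auto)
    ultimately show "runs (do {
        tick (1 + budget I);
        if e \<in> F then State_Monad.return xs
        else do {
          x \<leftarrow> eval_affine \<kappa> (const_coeff I e) (lin_coeff I e) \<mu>;
          insert_sorted \<kappa> (x, e) xs}}) (1 + n + (?T + (n * op_time \<kappa> ?W + 1))) (Inv (Suc j))"
      by (intro runs_bind) auto
  qed
  then show ?thesis
    by (rule runs_mono) (use n in \<open>auto simp: Inv_def\<close>)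
qed

lemma runs_greedy_basis:
  fixes I :: "('e, 'p::{finite, linorder}) interdiction"
  assumes I: "small_instance n I" and S: "n \<le> S" "\<And>i. frac_bits S (\<mu> $ i)"
    and Q: "\<And>d X. finite X \<Longrightarrow> snd (ind d X) \<le> poly Q (length d + card X)"
  shows "runs (greedy_basis \<kappa> ind I \<mu> F) (greedy_time \<kappa> Q CARD('p) n S)
    (\<lambda>B. length B \<le> n \<and> set B \<subseteq> ground I)"
  unfolding greedy_basis_def greedy_time_def
proof (rule runs_bind[OF runs_sort_remaining[OF I S]])
  fix xs assume xs: "length xs \<le> n \<and> snd ` set xs \<subseteq> ground I"
  let ?f = "\<lambda>(_, e) B. subroutine (ind (matroid_code I) (insert e (set B))) \<bind>
      (\<lambda>yes. State_Monad.return (if yes then e # B else B))"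
  have "runs (for_each xs [] ?f) (n * (poly Q (n + n) + 1) + 1)
      (\<lambda>B. length B \<le> length xs \<and> set B \<subseteq> ground I)"
  proof (rule runs_for_each[where Inv = "\<lambda>j B. length B \<le> j \<and> set B \<subseteq> ground I"])
    fix j x B
    assume j: "j < length xs" and x: "x \<in> set xs" and B: "length B \<le> j \<and> set B \<subseteq> ground I"
    obtain w e where we: "x = (w, e)" by force
    then have e: "e \<in> ground I" using x xs by force
    have "card (insert e (set B)) \<le> Suc (length B)"
      using card_length[of B] by (simp add: card_insert_if)
    then have "length (matroid_code I) + card (insert e (set B)) \<le> n + n"
      using B j xs I unfolding small_instance_def by linarith
    then have "snd (ind (matroid_code I) (insert e (set B))) \<le> poly Q (n + n)"
      using Q[of "insert e (set B)" "matroid_code I"] poly_nat_mono[of _ "n + n" Q] by (auto intro: order_trans)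
    then have "runs (?f x B) (poly Q (n + n) + 0) (\<lambda>B. length B \<le> Suc j \<and> set B \<subseteq> ground I)"
      unfolding we prod.case using B e
      by (intro runs_bind[where Q = "\<lambda>_. True"] runs_subroutine runs_return) auto
    then show "runs (?f x B) (poly Q (n + n)) (\<lambda>B. length B \<le> Suc j \<and> set B \<subseteq> ground I)"
      by simp
  qed (use xs in simp_all)
  then show "runs (for_each xs [] ?f) (n * (poly Q (n + n) + 1) + 1)
      (\<lambda>B. length B \<le> n \<and> set B \<subseteq> ground I)"
    by (rule runs_mono) (use xs in auto)
qed

text \<open>
  The bits of a sum of \<open>n\<close> numbers of \<open>n\<close> bits each; every addition costs one more bit.
\<close>

definition coeff_bits :: "nat \<Rightarrow> nat" where
  "coeff_bits n = n * (n + 1)"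

text \<open>
  Non-negativity lets a comparison of coefficients carry over to values at non-negative
  parameters; the bound on the bits confines the coefficients to a bounded part of the grid.
\<close>

definition small_coeffs :: "nat \<Rightarrow> rat \<times> 'p::finite ratvec \<Rightarrow> bool" where
  "small_coeffs k ab \<longleftrightarrow> 0 \<le> fst ab \<and> frac_bits k (fst ab) \<and>
     (\<forall>i. 0 \<le> snd ab $ i \<and> frac_bits k (snd ab $ i))"

definition coeffs_time :: "nat poly \<Rightarrow> nat \<Rightarrow> nat \<Rightarrow> nat" where
  "coeffs_time \<kappa> p n = n * (op_time \<kappa> (coeff_bits n) + 1) + 1 +
     (p * (n * (op_time \<kappa> (coeff_bits n) + 1) + 1 + 1) + 1)"

lemma runs_sum:
  assumes "length B \<le> n" "\<And>e. e \<in> set B \<Longrightarrow> 0 \<le> g e \<and> frac_bits n (g e)"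
  shows "runs (for_each B 0 (\<lambda>e s. arith \<kappa> (+) s (g e))) (n * (op_time \<kappa> (coeff_bits n) + 1) + 1)
    (\<lambda>s. 0 \<le> s \<and> frac_bits (coeff_bits n) s)"
proof -
  have le: "j * (n + 1) \<le> coeff_bits n" if "j \<le> n" for j
    unfolding coeff_bits_def using that by (rule mult_le_mono1)
  have "runs (for_each B 0 (\<lambda>e s. arith \<kappa> (+) s (g e)))
      (n * (op_time \<kappa> (coeff_bits n) + 1) + 1)
      (\<lambda>s. 0 \<le> s \<and> frac_bits (length B * (n + 1)) s)"
  proof (rule runs_for_each[where Inv = "\<lambda>j s. 0 \<le> s \<and> frac_bits (j * (n + 1)) s"])
    fix j e s assume j: "j < length B" and e: "e \<in> set B" and s: "0 \<le> s \<and> frac_bits (j * (n + 1)) s"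
    show "runs (arith \<kappa> (+) s (g e)) (op_time \<kappa> (coeff_bits n))
        (\<lambda>s. 0 \<le> s \<and> frac_bits (Suc j * (n + 1)) s)"
    proof (rule runs_arith)
      show "frac_bits (coeff_bits n) s" using s j assms(1) le[of j] by (auto elim: frac_bits_mono)
      show "frac_bits (coeff_bits n) (g e)"
        using assms(2)[OF e] by (auto simp: coeff_bits_def elim: frac_bits_mono)
      have "frac_bits (j * (n + 1) + n + 1) (s + g e)"
        using s assms(2)[OF e] by (intro frac_bits_add) auto
      then show "0 \<le> s + g e \<and> frac_bits (Suc j * (n + 1)) (s + g e)"
        using s assms(2)[OF e] by (simp add: algebra_simps)
    qed
  qed (use assms(1) in \<open>simp_all add: frac_bits_0\<close>)
  then show ?thesis
    by (rule runs_mono) (use le[OF assms(1)] in \<open>auto elim: frac_bits_mono\<close>)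
qed

lemma runs_basis_coeffs:
  fixes I :: "('e, 'p::{finite, linorder}) interdiction"
  assumes I: "small_instance n I" and B: "length B \<le> n" "set B \<subseteq> ground I"
    and nonneg: "\<And>e. e \<in> ground I \<Longrightarrow> 0 \<le> const_coeff I e \<and> (\<forall>i. 0 \<le> lin_coeff I e $ i)"
  shows "runs (basis_coeffs \<kappa> I B) (coeffs_time \<kappa> CARD('p) n) (small_coeffs (coeff_bits n))"
proof -
  let ?K = "coeff_bits n"
  have coeffs: "frac_bits n (const_coeff I e)" "frac_bits n (lin_coeff I e $ i)" if "e \<in> ground I" for e i
    using I that by (auto simp: small_instance_def)
  let ?g = "\<lambda>i (v :: 'p ratvec). for_each B 0 (\<lambda>e s. arith \<kappa> (+) s (lin_coeff I e $ i)) \<bind>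
      (\<lambda>s. State_Monad.return (\<chi> j. if j = i then s else v $ j))"
  have lin: "runs (for_each coordinates 0 ?g)
      (CARD('p) * (n * (op_time \<kappa> ?K + 1) + 1 + 1) + 1)
      (\<lambda>v. \<forall>i. 0 \<le> v $ i \<and> frac_bits ?K (v $ i))"
  proof (rule runs_for_each[where Inv = "\<lambda>_ v. \<forall>i. 0 \<le> v $ i \<and> frac_bits ?K (v $ i)"])
    fix j i and v :: "'p ratvec" assume v: "\<forall>i. 0 \<le> v $ i \<and> frac_bits ?K (v $ i)"
    have "runs (?g i v) (n * (op_time \<kappa> ?K + 1) + 1 + 0) (\<lambda>v. \<forall>i. 0 \<le> v $ i \<and> frac_bits ?K (v $ i))"
      by (rule runs_bind[OF runs_sum]) (use B coeffs nonneg v in \<open>auto intro!: runs_return\<close>)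
    then show "runs (?g i v) (n * (op_time \<kappa> ?K + 1) + 1) (\<lambda>v. \<forall>i. 0 \<le> v $ i \<and> frac_bits ?K (v $ i))"
      by simp
  qed (simp_all add: frac_bits_0 coordinates_facts)
  have "runs (basis_coeffs \<kappa> I B) (n * (op_time \<kappa> ?K + 1) + 1 +
      (CARD('p) * (n * (op_time \<kappa> ?K + 1) + 1 + 1) + 1 + 0)) (small_coeffs ?K)"
    unfolding basis_coeffs_def
  proof (rule runs_bind[OF runs_sum])
    fix a :: rat assume a: "0 \<le> a \<and> frac_bits ?K a"
    show "runs (for_each coordinates 0 ?g \<bind> (\<lambda>b. State_Monad.return (a, b)))
        (CARD('p) * (n * (op_time \<kappa> ?K + 1) + 1 + 1) + 1 + 0) (small_coeffs ?K)"
      by (rule runs_bind[OF lin]) (use a in \<open>auto intro!: runs_return simp: small_coeffs_def\<close>)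
  qed (use B coeffs nonneg in auto)
  then show ?thesis by (simp add: coeffs_time_def)
qed

section \<open>Counting affine functions up to a factor\<close>

text \<open>
  The interval of the logarithmic grid with ratio \<open>exp \<epsilon>\<close> that contains \<open>x\<close>. The flag separates
  \<open>0\<close> from the grid: since \<open>ln 0 = 0\<close>, the second component alone would put \<open>0\<close> and \<open>1\<close> into the
  same interval.
\<close>

definition grid_class :: "real \<Rightarrow> rat \<Rightarrow> bool \<times> int" where
  "grid_class \<epsilon> x = (x = 0, \<lfloor>ln (of_rat x) / \<epsilon>\<rfloor>)"

text \<open>
  Only \<open>0\<close> shares the class of \<open>0\<close>. For positive numbers, logarithms in the same interval differ
  by less than \<open>\<epsilon>\<close>, hence \<open>y > exp (- \<epsilon>) * x\<close>, and \<open>exp (- \<epsilon>) \<ge> 1 - \<epsilon>\<close>.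
\<close>

lemma grid_class_eq_imp_le:
  assumes "0 < \<epsilon>" "0 \<le> x" "0 \<le> y" "grid_class \<epsilon> x = grid_class \<epsilon> y"
  shows "(1 - \<epsilon>) * of_rat x \<le> of_rat y"
proof (cases "x = 0")
  case True
  with assms show ?thesis by simp
next
  case False
  with assms(4) have "y \<noteq> 0" by (simp add: grid_class_def)
  with False assms(2,3) have pos: "0 < (of_rat x :: real)" "0 < (of_rat y :: real)"
    by simp_all
  have "\<lfloor>ln (of_rat x) / \<epsilon>\<rfloor> = \<lfloor>ln (of_rat y) / \<epsilon>\<rfloor>"
    using assms(4) by (simp add: grid_class_def)
  then have "ln (of_rat x) / \<epsilon> - 1 < ln (of_rat y) / \<epsilon>"
    by linarith
  then have "ln (of_rat x) - \<epsilon> < ln (of_rat y)"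
    using mult_strict_right_mono[OF _ assms(1), of "ln (of_rat x) / \<epsilon> - 1"] assms(1)
    by (fastforce simp: left_diff_distrib)
  then have "exp (ln (of_rat x) - \<epsilon>) < of_rat y"
    using pos(2) by (metis exp_less_cancel_iff exp_ln)
  then have "of_rat x * exp (- \<epsilon>) < of_rat y"
    using pos(1) by (simp add: exp_diff exp_minus field_simps)
  moreover have "(1 - \<epsilon>) * of_rat x \<le> exp (- \<epsilon>) * of_rat x"
    using pos(1) exp_ge_add_one_self[of "- \<epsilon>"] by (intro mult_right_mono) auto
  ultimately show ?thesis by (simp add: mult.commute)
qed

lemma grid_class_range:
  assumes "0 < \<epsilon>" "1 / \<epsilon> \<le> real r" "0 \<le> x" "frac_bits k x"
  shows "grid_class \<epsilon> x \<in> UNIV \<times> {- int (k * r)..int (k * r)}"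
proof -
  have "\<bar>ln (of_rat x :: real)\<bar> \<le> real k"
    using abs_ln_le_if_frac_bits[OF assms(4)] assms(3) by (cases "x = 0") auto
  then have "\<bar>ln (of_rat x)\<bar> * (1 / \<epsilon>) \<le> real k * real r"
    using assms(1,2) by (intro mult_mono) auto
  then have "\<bar>ln (of_rat x) / \<epsilon>\<bar> \<le> real (k * r)"
    using assms(1) by (simp add: abs_divide)
  then have "of_int (- int (k * r)) \<le> ln (of_rat x) / \<epsilon>" "ln (of_rat x) / \<epsilon> \<le> of_int (int (k * r))"
    unfolding of_int_minus of_int_of_nat_eq by linarith+
  then have "- int (k * r) \<le> \<lfloor>ln (of_rat x) / \<epsilon>\<rfloor>" "\<lfloor>ln (of_rat x) / \<epsilon>\<rfloor> \<le> int (k * r)"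
    by linarith+
  then show ?thesis by (simp add: grid_class_def)
qed

definition grid_cell :: "real \<Rightarrow> rat \<times> 'p::finite ratvec \<Rightarrow> (bool \<times> int) \<times> ('p \<Rightarrow> bool \<times> int)" where
  "grid_cell \<epsilon> ab = (grid_class \<epsilon> (fst ab), \<lambda>i. grid_class \<epsilon> (snd ab $ i))"

text \<open>
  There are \<open>2\<close> flags and \<open>2 * k * r + 1\<close> intervals for each of the \<open>p + 1\<close> coefficients, where
  \<open>r\<close> is an upper bound for \<open>1 / \<epsilon>\<close>.
\<close>

definition grid_size :: "nat \<Rightarrow> nat \<Rightarrow> nat \<Rightarrow> nat" where
  "grid_size p k r = (2 * (2 * (k * r) + 1)) ^ (p + 1)"

lemma length_le_grid_size:
  fixes fs :: "(rat \<times> 'p::finite ratvec) list"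
  assumes "0 < \<epsilon>" "1 / \<epsilon> \<le> real r" "\<And>ab. ab \<in> set fs \<Longrightarrow> small_coeffs k ab"
    and "distinct (map (grid_cell \<epsilon>) fs)"
  shows "length fs \<le> grid_size CARD('p) k r"
proof -
  define G where "G = (UNIV :: bool set) \<times> {- int (k * r)..int (k * r)}"
  have G: "finite G" "card G = 2 * (2 * (k * r) + 1)"
    by (simp_all add: G_def card_cartesian_product nat_add_distrib nat_mult_distrib)
  have range: "grid_class \<epsilon> x \<in> G" if "0 \<le> x" "frac_bits k x" for x
    using grid_class_range[OF assms(1,2) that] unfolding G_def .
  have "grid_cell \<epsilon> ab \<in> G \<times> (UNIV \<rightarrow>\<^sub>E G)" if "ab \<in> set fs" for ab
    using assms(3)[OF that] by (auto simp: grid_cell_def small_coeffs_def intro: range)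
  then have sub: "set (map (grid_cell \<epsilon>) fs) \<subseteq> G \<times> (UNIV \<rightarrow>\<^sub>E G)"
    unfolding set_map by (rule image_subsetI)
  have "length fs = card (set (map (grid_cell \<epsilon>) fs))"
    using distinct_card[OF assms(4)] by simp
  also have "\<dots> \<le> card (G \<times> ((UNIV :: 'p set) \<rightarrow>\<^sub>E G))"
    by (rule card_mono[OF _ sub]) (use G in \<open>auto intro!: finite_PiE\<close>)
  also have "\<dots> = grid_size CARD('p) k r"
    by (simp add: card_cartesian_product card_PiE G grid_size_def)
  finally show ?thesis .
qed

definition affine_value :: "rat \<times> 'p::finite ratvec \<Rightarrow> real ^ 'p \<Rightarrow> real" where
  "affine_value ab \<mu> = of_rat (fst ab) + real_vec (snd ab) \<bullet> \<mu>"

text \<open>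
  The comparison of the coefficients is inherited by the values because \<open>\<mu>\<close> is non-negative.
\<close>

lemma affine_value_grid_cell:
  fixes ab :: "rat \<times> 'p::finite ratvec"
  assumes "0 < \<epsilon>" "small_coeffs k ab" "small_coeffs k ab'" "grid_cell \<epsilon> ab = grid_cell \<epsilon> ab'"
    and "\<And>i. 0 \<le> \<mu> $ i"
  shows "(1 - \<epsilon>) * affine_value ab \<mu> \<le> affine_value ab' \<mu>"
proof -
  have "(1 - \<epsilon>) * of_rat (fst ab) \<le> of_rat (fst ab')"
    using assms(2-4) by (intro grid_class_eq_imp_le assms(1)) (auto simp: small_coeffs_def grid_cell_def)
  moreover have "(1 - \<epsilon>) * (real_vec (snd ab) \<bullet> \<mu>) \<le> real_vec (snd ab') \<bullet> \<mu>"
    unfolding inner_vec_def sum_distrib_left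
  proof (rule sum_mono)
    fix i
    have "(1 - \<epsilon>) * of_rat (snd ab $ i) \<le> of_rat (snd ab' $ i)"
      using assms(2-4)
      by (intro grid_class_eq_imp_le assms(1)) (auto simp: small_coeffs_def grid_cell_def fun_eq_iff)
    from mult_right_mono[OF this assms(5)[of i]]
    show "(1 - \<epsilon>) * (real_vec (snd ab) $ i \<bullet> \<mu> $ i) \<le> real_vec (snd ab') $ i \<bullet> \<mu> $ i"
      by (simp add: real_vec_def mult.assoc)
  qed
  ultimately show ?thesis by (simp add: affine_value_def algebra_simps)
qed

section \<open>The polyhedra of the algorithm\<close>

text \<open>
  The part of the cylinder over \<open>region hs\<close> that lies above the graphs of the functions \<open>fs\<close>.
\<close>

definition upper_region :: "(rat \<times> 'p::finite ratvec) list \<Rightarrow> ('p ratvec \<times> rat) list \<Rightarrow> 'p halfspace list" where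
  "upper_region fs hs = map (\<lambda>(a, b). phi a b) fs @ cylinder hs"

lemma mem_point_region_upper_region:
  "(\<mu>, z) \<in> point_region (upper_region fs hs) \<longleftrightarrow>
     \<mu> \<in> region hs \<and> (\<forall>ab\<in>set fs. affine_value ab \<mu> \<le> z)"
proof -
  have "real_vec b \<bullet> \<mu> - z \<le> - of_rat a \<longleftrightarrow> affine_value (a, b) \<mu> \<le> z" for a b
    by (auto simp: affine_value_def)
  then show ?thesis
    by (auto simp: point_region_def upper_region_def phi_def cylinder_def region_def real_point_def
        of_rat_minus ball_Un split: prod.splits)
qed

text \<open>
  Vertex enumeration is specified for full-dimensional polyhedra only. Above an interior point of
  the base, every sufficiently high point lies strictly above all graphs.
\<close>

lemma interior_point_region_upper_region:
  assumes "interior (region hs) \<noteq> {}"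
  shows "interior (point_region (upper_region fs hs)) \<noteq> {}"
proof -
  obtain \<mu> where \<mu>: "\<mu> \<in> interior (region hs)" using assms by blast
  define U where "U = (interior (region hs) \<times> UNIV) \<inter> (\<Inter>ab\<in>set fs. {x. affine_value ab (fst x) < snd x})"
  have "open {x. affine_value ab (fst x) < snd x}" for ab :: "rat \<times> 'a ratvec"
    unfolding affine_value_def by (intro open_Collect_less continuous_intros)
  then have "open U"
    unfolding U_def by (intro open_Int open_INT open_Times) auto
  moreover have "U \<subseteq> point_region (upper_region fs hs)"
    using interior_subset[of "region hs"]
    by (auto simp: U_def mem_point_region_upper_region less_imp_le)
  moreover have "(\<mu>, 1 + (\<Sum>ab\<leftarrow>fs. \<bar>affine_value ab \<mu>\<bar>)) \<in> U"
  proof -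
    have "affine_value ab \<mu> < 1 + (\<Sum>ab\<leftarrow>fs. \<bar>affine_value ab \<mu>\<bar>)" if "ab \<in> set fs" for ab
      using that
    proof (induction fs)
      case (Cons x xs)
      have "0 \<le> (\<Sum>ab\<leftarrow>xs. \<bar>affine_value ab \<mu>\<bar>)" by (intro sum_list_nonneg) auto
      with Cons show ?case by auto
    qed simp
    with \<mu> show ?thesis by (auto simp: U_def)
  qed
  ultimately have "(\<mu>, 1 + (\<Sum>ab\<leftarrow>fs. \<bar>affine_value ab \<mu>\<bar>)) \<in> interior (point_region (upper_region fs hs))"
    by (blast intro: interiorI)
  then show ?thesis by blast
qed

lemma convex_region: "convex (region hs)"
proof -
  have "region hs = (\<Inter>(u, t)\<in>set hs. {\<mu>. real_vec u \<bullet> \<mu> \<le> of_rat t})"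
    by (auto simp: region_def)
  also have "convex \<dots>"
    by (intro convex_INT) (auto simp: convex_halfspace_le)
  finally show ?thesis .
qed

text \<open>
  A cell is a closure of a full-dimensional set, and it is convex as an intersection of
  half-spaces.
\<close>

lemma interior_cell:
  fixes I :: "('e, 'p::finite) interdiction"
  assumes "cell I c" "describes_cell I c hs"
  shows "interior (region hs) \<noteq> {}"
proof -
  obtain C where C: "aff_dim C = int CARD('p)" "c = closure C" using assms(1) by (auto simp: cell_def)
  have c: "region hs = c" using assms(2) by (simp add: describes_cell_def)
  have dim: "aff_dim c = int DIM(real ^ 'p)" using C by simp
  then have "affine hull c = UNIV" using aff_dim_eq_full[of c] by simp
  then have "interior c = rel_interior c" by (simp add: rel_interior_interior)
  moreover have "c \<noteq> {}" using dim by auto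
  then have "rel_interior c \<noteq> {}" using rel_interior_eq_empty convex_region[of hs] c by metis
  ultimately show ?thesis by (simp add: c)
qed

lemma cell_subset_param_set:
  assumes "cell I c" "compact (param_set I)"
  shows "c \<subseteq> param_set I"
  using assms closure_minimal[of _ "param_set I"] compact_imp_closed by (auto simp: cell_def)

lemma rat_length_pos: "1 \<le> rat_length x"
  by (simp add: rat_length_def int_length_def split: prod.split)

lemma point_length_pos: "1 \<le> point_length v"
  unfolding point_length_def using rat_length_pos[of "snd v"] by simp

lemma rat_length_le_vec_length: "rat_length (v $ i) \<le> vec_length v"
  unfolding vec_length_def by (rule member_le_sum) auto

lemma length_le_sum_list:
  assumes "\<And>x. x \<in> set xs \<Longrightarrow> 1 \<le> g x"
  shows "length xs \<le> (\<Sum>x\<leftarrow>xs. g x :: nat)"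
  using assms by (induction xs) (simp, force)

lemma halfspace_length_le:
  fixes h :: "'p::finite halfspace"
  assumes "\<And>i. frac_bits k (fst (fst h) $ i)" "frac_bits k (snd (fst h))" "frac_bits k (snd h)"
  shows "halfspace_length h \<le> (CARD('p) + 2) * (2 * k + 4)"
proof -
  have "vec_length (fst (fst h)) \<le> CARD('p) * (2 * k + 4)"
    unfolding vec_length_def
    using sum_bounded_above[of "UNIV :: 'p set" "\<lambda>i. rat_length (fst (fst h) $ i)" "2 * k + 4"]
    by (simp add: rat_length_le_if_frac_bits assms(1))
  then show ?thesis
    using rat_length_le_if_frac_bits[OF assms(2)] rat_length_le_if_frac_bits[OF assms(3)]
    by (simp add: halfspace_length_def point_length_def)
qed

text \<open>
  The half-spaces \<open>\<phi>(F)\<close> have entries of \<open>coeff_bits n\<close> bits, and those of the cylinder are input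
  numbers or differences of two input numbers, with at most \<open>2 * n + 1\<close> bits. The sum dominates
  both.
\<close>

definition halfspace_bound :: "nat \<Rightarrow> nat \<Rightarrow> nat" where
  "halfspace_bound p n = (p + 2) * (2 * (coeff_bits n + (2 * n + 1)) + 4)"

text \<open>
  A cell is described by at most \<open>n * n\<close> comparisons of elements and \<open>n\<close> half-spaces of the
  parameter polytope; each visited grid cell contributes one more half-space.
\<close>

definition facet_bound :: "nat \<Rightarrow> nat \<Rightarrow> nat" where
  "facet_bound p n = n * n + n + grid_size p (coeff_bits n) n"

text \<open>
  This bounds the time of every vertex enumeration, and with it the number of vertices and their
  encoding lengths, since writing them down takes time. The factor \<open>log\<close> of the enumeration
  algorithm is replaced by the number of facets.
\<close>

definition vertex_bound :: "nat poly \<Rightarrow> nat \<Rightarrow> nat \<Rightarrow> nat" where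
  "vertex_bound Q p n = (facet_bound p n * facet_bound p n + facet_bound p n ^ ((p + 1) div 2)) *
     poly Q (halfspace_bound p n)"

definition small_halfspaces :: "nat \<Rightarrow> ('p::finite ratvec \<times> rat) list \<Rightarrow> bool" where
  "small_halfspaces n hs \<longleftrightarrow> length hs \<le> n * n + n \<and>
     (\<forall>(u, t)\<in>set hs. (\<forall>i. frac_bits (2 * n + 1) (u $ i)) \<and> frac_bits (2 * n + 1) t)"

lemma halfspace_length_cylinder:
  fixes hs :: "('p::finite ratvec \<times> rat) list"
  assumes "small_halfspaces n hs" "h \<in> set (cylinder hs)"
  shows "halfspace_length h \<le> halfspace_bound CARD('p) n"
proof -
  define k where "k = coeff_bits n + (2 * n + 1)"
  have mono: "frac_bits k x" if "frac_bits (Suc (2 * n)) x" for x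
    using that by (rule frac_bits_mono) (simp add: k_def)
  show ?thesis
    unfolding halfspace_bound_def k_def[symmetric]
    by (rule halfspace_length_le)
      (use assms in \<open>auto simp: small_halfspaces_def cylinder_def frac_bits_0 split: prod.splits intro!: mono\<close>)
qed

lemma halfspace_length_upper_region:
  fixes hs :: "('p::finite ratvec \<times> rat) list"
  assumes "small_halfspaces n hs" "\<And>ab. ab \<in> set fs \<Longrightarrow> small_coeffs (coeff_bits n) ab"
    and "h \<in> set (upper_region fs hs)"
  shows "halfspace_length h \<le> halfspace_bound CARD('p) n"
proof (cases "h \<in> set (cylinder hs)")
  case True
  with assms(1) show ?thesis by (rule halfspace_length_cylinder)
next
  case False
  then obtain a b where ab: "(a, b) \<in> set fs" "h = phi a b"
    using assms(3) by (auto simp: upper_region_def)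
  define k where "k = coeff_bits n + (2 * n + 1)"
  have mono: "frac_bits k x" if "frac_bits (coeff_bits n) x" for x
    using that by (rule frac_bits_mono) (simp add: k_def)
  have "frac_bits 0 (- 1)"
    unfolding frac_bits_def by (intro exI[of _ "- 1"] exI[of _ 1]) simp
  then have "frac_bits k (- 1)" by (rule frac_bits_mono) simp
  then show ?thesis
    unfolding halfspace_bound_def k_def[symmetric]
    by (intro halfspace_length_le)
      (use assms(2)[OF ab(1)] in \<open>auto simp: ab(2) phi_def small_coeffs_def intro!: mono frac_bits_uminus\<close>)
qed

text \<open>
  The property \<open>chazelle_enumeration\<close> with its polynomial made explicit.
\<close>

definition enumerates_vertices_within ::
    "nat poly \<Rightarrow> ('p::finite halfspace list \<Rightarrow> 'p point list \<times> nat) \<Rightarrow> bool" where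
  "enumerates_vertices_within Q enum \<longleftrightarrow> (\<forall>A. A \<noteq> [] \<and> interior (point_region A) \<noteq> {} \<longrightarrow>
        (case enum A of (vs, t) \<Rightarrow>
           distinct vs \<and>
           real_point ` set vs = {v. v extreme_point_of point_region A} \<and>
           (\<Sum>v\<leftarrow>vs. point_length v) \<le> t \<and>
           real t \<le> (real (length A) * log 2 (length A) + real (length A) ^ ((CARD('p) + 1) div 2)) *
                    poly Q (Max (halfspace_length ` set A))))"

text \<open>
  The functions and the description of the cell bound the number of facets, hence the time of the
  enumeration. Every vertex takes at least one unit of time to be written down, so the time also
  bounds the number of vertices.
\<close>

lemma enumerated_vertices:
  fixes hs :: "('p::finite ratvec \<times> rat) list"
  assumes enum: "enumerates_vertices_within Q enum"
    and hs: "small_halfspaces n hs" "interior (region hs) \<noteq> {}"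
    and fs: "fs \<noteq> []" "length fs \<le> grid_size CARD('p) (coeff_bits n) n"
      "\<And>ab. ab \<in> set fs \<Longrightarrow> small_coeffs (coeff_bits n) ab"
  defines "A \<equiv> upper_region fs hs" and "V \<equiv> vertex_bound Q CARD('p) n"
  shows "snd (enum A) \<le> V" "length (fst (enum A)) \<le> V"
    and "\<And>v. v \<in> set (fst (enum A)) \<Longrightarrow> point_length v \<le> V \<and> real_point v \<in> point_region A"
proof -
  obtain vs t where vt: "enum A = (vs, t)" by force
  have ne: "A \<noteq> []" using fs(1) by (simp add: A_def upper_region_def)
  have "interior (point_region A) \<noteq> {}"
    unfolding A_def using hs(2) by (rule interior_point_region_upper_region)
  with enum ne vt have spec: "real_point ` set vs = {v. v extreme_point_of point_region A}"
      "(\<Sum>v\<leftarrow>vs. point_length v) \<le> t"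
      "real t \<le> (real (length A) * log 2 (length A) + real (length A) ^ ((CARD('p) + 1) div 2)) *
         real (poly Q (Max (halfspace_length ` set A)))"
    unfolding enumerates_vertices_within_def by fastforce+
  have lenA: "length A \<le> facet_bound CARD('p) n"
    using hs(1) fs(2) by (simp add: A_def upper_region_def cylinder_def small_halfspaces_def facet_bound_def)
  have "Max (halfspace_length ` set A) \<le> halfspace_bound CARD('p) n"
    using ne halfspace_length_upper_region[OF hs(1) fs(3)] by (auto simp: A_def)
  then have H: "poly Q (Max (halfspace_length ` set A)) \<le> poly Q (halfspace_bound CARD('p) n)"
    by (rule poly_nat_mono)
  have "log 2 (length A) \<le> real (length A)"
    using ne less_exp[of "length A"] by (intro log2_of_power_le) auto
  then have "real (length A) * log 2 (length A) \<le> real (length A) * real (length A)"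
    by (intro mult_left_mono) auto
  then have "real t \<le> (real (length A) * real (length A) + real (length A) ^ ((CARD('p) + 1) div 2)) *
      real (poly Q (Max (halfspace_length ` set A)))"
    by (intro order_trans[OF spec(3)] mult_right_mono) auto
  then have "real t \<le> real ((length A * length A + length A ^ ((CARD('p) + 1) div 2)) *
      poly Q (Max (halfspace_length ` set A)))"
    by simp
  then have "t \<le> (length A * length A + length A ^ ((CARD('p) + 1) div 2)) *
      poly Q (Max (halfspace_length ` set A))"
    by (simp only: of_nat_le_iff)
  also have "\<dots> \<le> V"
    unfolding V_def vertex_bound_def using lenA H by (intro mult_le_mono add_mono power_mono) auto
  finally have t: "t \<le> V" .
  then show "snd (enum A) \<le> V" by (simp add: vt)
  have "length vs \<le> (\<Sum>v\<leftarrow>vs. point_length v)"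
    using point_length_pos by (intro length_le_sum_list) auto
  with spec(2) t show "length (fst (enum A)) \<le> V" by (simp add: vt)
  fix v assume v: "v \<in> set (fst (enum A))"
  then have "real_point v extreme_point_of point_region A" using spec(1) by (auto simp: vt)
  moreover have "point_length v \<le> (\<Sum>v\<leftarrow>vs. point_length v)"
    using v by (intro member_le_sum_list) (auto simp: vt)
  ultimately show "point_length v \<le> V \<and> real_point v \<in> point_region A"
    using spec(2) t by (auto simp: extreme_point_of_def)
qed

section \<open>The loop of the Cell Algorithm\<close>

text \<open>
  The duration of the call is bounded by the slowest call recorded on the final clock. This form
  adds up over several calls, because the record never decreases.
\<close>

definition runs_with_oracle_call :: "'a timed \<Rightarrow> nat \<Rightarrow> ('a \<Rightarrow> bool) \<Rightarrow> bool" where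
  "runs_with_oracle_call m T Q \<longleftrightarrow> (\<forall>clk.
     elapsed (snd (run_state m clk)) \<le> elapsed clk + T + slowest_call (snd (run_state m clk)) \<and>
     slowest_call clk \<le> slowest_call (snd (run_state m clk)) \<and> Q (fst (run_state m clk)))"

lemma runs_with_oracle_call_bind:
  assumes "\<And>x. runs (f x) T Q"
  shows "runs_with_oracle_call (oracle_call r \<bind> f) T Q"
  unfolding runs_with_oracle_call_def
proof
  fix clk :: clock
  define clk' where "clk' =
    clk\<lparr>slowest_call := max (slowest_call clk) (snd r), elapsed := elapsed clk + snd r\<rparr>"
  have eq: "run_state (oracle_call r \<bind> f) clk = run_state (f (fst r)) clk'"
    by (simp add: oracle_call_def subroutine_def State_Monad.update_def clk'_def)
  have "elapsed (snd (run_state (f (fst r)) clk')) \<le> elapsed clk' + T"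
      "slowest_call (snd (run_state (f (fst r)) clk')) = slowest_call clk'"
      "Q (fst (run_state (f (fst r)) clk'))"
    using assms by (auto simp: runs_def)
  then show "elapsed (snd (run_state (oracle_call r \<bind> f) clk)) \<le>
        elapsed clk + T + slowest_call (snd (run_state (oracle_call r \<bind> f) clk)) \<and>
      slowest_call clk \<le> slowest_call (snd (run_state (oracle_call r \<bind> f) clk)) \<and>
      Q (fst (run_state (oracle_call r \<bind> f) clk))"
    unfolding eq by (auto simp: clk'_def)
qed

text \<open>
  Bits of all coordinates and coefficients that occur in a step: of the starting point, of the
  vertices, of the weight functions of bases and of the instance itself.
\<close>

definition point_bits :: "nat poly \<Rightarrow> nat poly \<Rightarrow> nat \<Rightarrow> nat \<Rightarrow> nat" where
  "point_bits Qp Qe p n = poly Qp n + vertex_bound Qe p n + coeff_bits n + n"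

text \<open>
  A bound for the time, without oracle call, of one pass through the loop and also of the
  initialization.
\<close>

definition step_time :: "nat poly \<Rightarrow> nat poly \<Rightarrow> nat poly \<Rightarrow> nat poly \<Rightarrow> nat \<Rightarrow> nat \<Rightarrow> nat" where
  "step_time \<kappa> Qi Qp Qe p n =
     greedy_time \<kappa> Qi p n (point_bits Qp Qe p n) +
     (coeffs_time \<kappa> p n +
     (affine_time \<kappa> p (point_bits Qp Qe p n) +
     (op_time \<kappa> (affine_bits p (point_bits Qp Qe p n)) +
     ((n * n + n) * halfspace_bound p n + vertex_bound Qe p n))))"

text \<open>
  An upper bound for the potential \<open>remaining\<close> below.
\<close>

definition steps_bound :: "nat poly \<Rightarrow> nat \<Rightarrow> nat \<Rightarrow> nat" where
  "steps_bound Qe p n = grid_size p (coeff_bits n) n * (vertex_bound Qe p n + 1) + vertex_bound Qe p n"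

text \<open>
  A run on a fixed cell. The number \<open>n\<close> bounds both \<open>1 / \<epsilon>\<close> and the size of the instance, so that
  all estimates depend on a single variable.
\<close>

locale cell_run =
  fixes \<kappa> Qi Qp Qe :: "nat poly"
    and ind :: "bool list \<Rightarrow> 'e set \<Rightarrow> bool \<times> nat"
    and enum :: "'p::{finite, linorder} halfspace list \<Rightarrow> 'p point list \<times> nat"
    and I :: "('e, 'p) interdiction"
    and \<epsilon> :: real and n :: nat
    and hs :: "('p ratvec \<times> rat) list" and \<mu>\<^sub>0 :: "'p ratvec"
  assumes \<epsilon>: "0 < \<epsilon>" "1 / \<epsilon> \<le> real n"
    and small: "small_instance n I"
    and nonneg_coeffs: "\<And>e. e \<in> ground I \<Longrightarrow> 0 \<le> const_coeff I e \<and> (\<forall>i. 0 \<le> lin_coeff I e $ i)"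
    and ind_time: "\<And>d X. finite X \<Longrightarrow> snd (ind d X) \<le> poly Qi (length d + card X)"
    and enum: "enumerates_vertices_within Qe enum"
    and hs: "small_halfspaces n hs" "interior (region hs) \<noteq> {}"
    and nonneg_params: "\<And>\<mu> i. \<mu> \<in> region hs \<Longrightarrow> 0 \<le> \<mu> $ i"
    and start_bits: "vec_length \<mu>\<^sub>0 \<le> poly Qp n"
begin

text \<open>
  The loop invariant: \<open>fs\<close> are the weight functions whose half-spaces were added so far. That they
  lie in distinct grid cells bounds their number.
\<close>

definition explained_by :: "('e, 'p) cell_state \<Rightarrow> (rat \<times> 'p ratvec) list \<Rightarrow> bool" where
  "explained_by st fs \<longleftrightarrow> fs \<noteq> [] \<and>
     (\<forall>ab\<in>set fs. small_coeffs (coeff_bits n) ab) \<and> distinct (map (grid_cell \<epsilon>) fs) \<and>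
     polyhedron_rep st = upper_region fs hs \<and>
     length (unexamined st) \<le> vertex_bound Qe CARD('p) n \<and>
     (\<forall>v\<in>set (unexamined st).
        point_length v \<le> vertex_bound Qe CARD('p) n \<and>
        real_point v \<in> point_region (polyhedron_rep st))"

text \<open>
  The potential of the loop. The difference in the first factor is the number of grid cells that
  are still available for a restart; a restart uses up one of them and produces at most
  \<open>vertex_bound\<close> new vertices to be examined.
\<close>

definition remaining :: "('e, 'p) cell_state \<Rightarrow> nat" where
  "remaining st =
     (grid_size CARD('p) (coeff_bits n) n + length hs - length (polyhedron_rep st)) *
       (vertex_bound Qe CARD('p) n + 1) +
     length (unexamined st)"

lemma remaining_le: "explained_by st fs \<Longrightarrow> remaining st \<le> steps_bound Qe CARD('p) n"
  unfolding remaining_def steps_bound_def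
  by (intro add_mono mult_le_mono1) (auto simp: explained_by_def upper_region_def cylinder_def)

lemma greedy_coeffs:
  assumes "\<And>a b. small_coeffs (coeff_bits n) (a, b) \<Longrightarrow> runs (f (a, b)) T' Q"
  shows "runs (greedy_basis \<kappa> ind I \<mu>\<^sub>0 F \<bind> (\<lambda>B. basis_coeffs \<kappa> I B \<bind> f))
     (greedy_time \<kappa> Qi CARD('p) n (point_bits Qp Qe CARD('p) n) + (coeffs_time \<kappa> CARD('p) n + T')) Q"
proof (rule runs_bind[OF runs_greedy_basis])
  show "small_instance n I" by (rule small)
  show "n \<le> point_bits Qp Qe CARD('p) n" by (simp add: point_bits_def)
  show "frac_bits (point_bits Qp Qe CARD('p) n) (\<mu>\<^sub>0 $ i)" for i
    using rat_length_le_vec_length[of \<mu>\<^sub>0 i] start_bits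
    by (intro frac_bits_if_rat_length_le) (simp add: point_bits_def)
  fix B assume B: "length B \<le> n \<and> set B \<subseteq> ground I"
  show "runs (basis_coeffs \<kappa> I B \<bind> f) (coeffs_time \<kappa> CARD('p) n + T') Q"
  proof (rule runs_bind[OF runs_basis_coeffs[OF small]])
    fix ab :: "rat \<times> 'p ratvec" assume "small_coeffs (coeff_bits n) ab"
    then show "runs (f ab) T' Q" using assms[of "fst ab" "snd ab"] by simp
  qed (use B nonneg_coeffs in auto)
qed (rule ind_time)

lemma new_polyhedron:
  assumes fs: "fs \<noteq> []" "\<And>ab. ab \<in> set fs \<Longrightarrow> small_coeffs (coeff_bits n) ab"
    "distinct (map (grid_cell \<epsilon>) fs)"
  shows "runs (do {vs \<leftarrow> subroutine (enum (upper_region fs hs));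
       State_Monad.return \<lparr>found = X, polyhedron_rep = upper_region fs hs, unexamined = vs\<rparr>})
     (vertex_bound Qe CARD('p) n)
     (\<lambda>st. explained_by st fs)"
proof -
  let ?N = "grid_size CARD('p) (coeff_bits n) n"
    and ?V = "vertex_bound Qe CARD('p) n"
  have len: "length fs \<le> ?N"
    by (rule length_le_grid_size[OF \<epsilon> fs(2,3)])
  note vs = enumerated_vertices[OF enum hs fs(1) len fs(2)]
  have "runs (do {vs \<leftarrow> subroutine (enum (upper_region fs hs));
       State_Monad.return \<lparr>found = X, polyhedron_rep = upper_region fs hs, unexamined = vs\<rparr>}) (?V + 0)
     (\<lambda>st. explained_by st fs)"
  proof (rule runs_bind[OF runs_subroutine[where Q = "\<lambda>vs. vs = fst (enum (upper_region fs hs))"]])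
    fix us assume us: "us = fst (enum (upper_region fs hs))"
    show "runs (State_Monad.return \<lparr>found = X, polyhedron_rep = upper_region fs hs, unexamined = us\<rparr>) 0
        (\<lambda>st. explained_by st fs)"
      using fs vs(2,3) by (intro runs_return) (auto simp: explained_by_def us)
  qed (use vs(1) in auto)
  then show ?thesis by simp
qed

lemma runs_init:
  "runs (greedy_basis \<kappa> ind I \<mu>\<^sub>0 F \<bind> (\<lambda>B. basis_coeffs \<kappa> I B \<bind> (\<lambda>(a, b). do {
     tick (\<Sum>h\<leftarrow>cylinder hs. halfspace_length h);
     let A = phi a b # cylinder hs;
     vs \<leftarrow> subroutine (enum A);
     State_Monad.return \<lparr>found = {F}, polyhedron_rep = A, unexamined = vs\<rparr>})))
   (step_time \<kappa> Qi Qp Qe CARD('p) n)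
   (\<lambda>st. \<exists>fs. explained_by st fs)"
proof -
  let ?V = "vertex_bound Qe CARD('p) n"
    and ?S = "point_bits Qp Qe CARD('p) n"
  have "runs (do {
      tick (\<Sum>h\<leftarrow>cylinder hs. halfspace_length h);
      let A = phi a b # cylinder hs;
      vs \<leftarrow> subroutine (enum A);
      State_Monad.return \<lparr>found = {F}, polyhedron_rep = A, unexamined = vs\<rparr>})
      ((n * n + n) * halfspace_bound CARD('p) n + ?V)
      (\<lambda>st. \<exists>fs. explained_by st fs)" (is "runs ?m _ _")
    if ab: "small_coeffs (coeff_bits n) (a, b)" for a b
  proof (rule runs_bind)
    have "(\<Sum>h\<leftarrow>cylinder hs. halfspace_length h) \<le> length (cylinder hs) * halfspace_bound CARD('p) n"
      using sum_list_mono[of "cylinder hs" halfspace_length "\<lambda>_. halfspace_bound CARD('p) n"]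
        halfspace_length_cylinder[OF hs(1)] by (simp add: sum_list_triv)
    also have "\<dots> \<le> (n * n + n) * halfspace_bound CARD('p) n"
      using hs(1) by (intro mult_le_mono1) (simp add: cylinder_def small_halfspaces_def)
    finally show "runs (tick (\<Sum>h\<leftarrow>cylinder hs. halfspace_length h))
        ((n * n + n) * halfspace_bound CARD('p) n) (\<lambda>_. True)"
      by (rule runs_mono[OF runs_tick]) auto
    have "phi a b # cylinder hs = upper_region [(a, b)] hs" by (simp add: upper_region_def)
    then show "runs (let A = phi a b # cylinder hs in do {
        vs \<leftarrow> subroutine (enum A);
        State_Monad.return \<lparr>found = {F}, polyhedron_rep = A, unexamined = vs\<rparr>}) ?V
        (\<lambda>st. \<exists>fs. explained_by st fs)"
      unfolding Let_def using ab
      by (auto intro: runs_mono[OF new_polyhedron[of "[(a, b)]"] order_refl])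
  qed
  then have "runs (greedy_basis \<kappa> ind I \<mu>\<^sub>0 F \<bind> (\<lambda>B. basis_coeffs \<kappa> I B \<bind> (\<lambda>(a, b). do {
     tick (\<Sum>h\<leftarrow>cylinder hs. halfspace_length h);
     let A = phi a b # cylinder hs;
     vs \<leftarrow> subroutine (enum A);
     State_Monad.return \<lparr>found = {F}, polyhedron_rep = A, unexamined = vs\<rparr>})))
     (greedy_time \<kappa> Qi CARD('p) n ?S + (coeffs_time \<kappa> CARD('p) n +
       ((n * n + n) * halfspace_bound CARD('p) n + ?V)))
     (\<lambda>st. \<exists>fs. explained_by st fs)"
    by (intro greedy_coeffs) auto
  then show ?thesis by (rule runs_mono) (simp_all add: step_time_def)
qed

text \<open>
  The value \<open>z\<close> is at least the value at \<open>\<mu>\<close> of every function in \<open>fs\<close>. If one of them shared its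
  grid cell with the new function, then \<open>1 - \<epsilon>\<close> times the new value would not exceed \<open>z\<close>.
\<close>

lemma violated_new_grid_cell:
  assumes st: "explained_by st fs" "(\<mu>, z) \<in> set (unexamined st)"
    and ab: "small_coeffs (coeff_bits n) (a, b)"
    and violated: "(1 - \<epsilon>) * of_rat (a + (\<Sum>i\<in>UNIV. \<mu> $ i * b $ i)) > (of_rat z :: real)"
  shows "grid_cell \<epsilon> (a, b) \<notin> grid_cell \<epsilon> ` set fs"
proof
  assume "grid_cell \<epsilon> (a, b) \<in> grid_cell \<epsilon> ` set fs"
  then obtain ab' where ab': "ab' \<in> set fs" "grid_cell \<epsilon> (a, b) = grid_cell \<epsilon> ab'" by auto
  have "(real_vec \<mu>, of_rat z) \<in> point_region (upper_region fs hs)"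
    using st by (auto simp: explained_by_def real_point_def)
  then have \<mu>: "real_vec \<mu> \<in> region hs" "affine_value ab' (real_vec \<mu>) \<le> of_rat z"
    using ab'(1) by (auto simp: mem_point_region_upper_region)
  have "(1 - \<epsilon>) * affine_value (a, b) (real_vec \<mu>) \<le> affine_value ab' (real_vec \<mu>)"
    using st(1) ab' by (intro affine_value_grid_cell[OF \<epsilon>(1) ab] nonneg_params \<mu>(1))
      (auto simp: explained_by_def)
  moreover have "affine_value (a, b) (real_vec \<mu>) = of_rat (a + (\<Sum>i\<in>UNIV. \<mu> $ i * b $ i))"
    by (simp add: affine_value_def inner_vec_def real_vec_def of_rat_add of_rat_sum of_rat_mult mult.commute)
  ultimately show False using \<mu>(2) violated by simp
qed

lemma runs_examine:
  assumes st: "explained_by st fs" and hd: "unexamined st = (\<mu>, z) # us"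
  shows "runs (greedy_basis \<kappa> ind I \<mu>\<^sub>0 F \<bind> (\<lambda>B. basis_coeffs \<kappa> I B \<bind> (\<lambda>(a, b). do {
     v \<leftarrow> eval_affine \<kappa> a b \<mu>;
     violated \<leftarrow> arith \<kappa> (\<lambda>v z. (1 - \<epsilon>) * of_rat v > of_rat z) v z;
     if violated then do {
       let A = phi a b # polyhedron_rep st;
       vs \<leftarrow> subroutine (enum A);
       State_Monad.return \<lparr>found = insert F (found st), polyhedron_rep = A, unexamined = vs\<rparr>}
     else State_Monad.return (st\<lparr>unexamined := tl (unexamined st)\<rparr>)})))
   (step_time \<kappa> Qi Qp Qe CARD('p) n)
   (\<lambda>st'. (\<exists>fs. explained_by st' fs) \<and> remaining st' < remaining st)"
proof -
  let ?N = "grid_size CARD('p) (coeff_bits n) n"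
    and ?V = "vertex_bound Qe CARD('p) n"
    and ?S = "point_bits Qp Qe CARD('p) n"
  let ?Q = "\<lambda>st'. (\<exists>fs. explained_by st' fs) \<and> remaining st' < remaining st"
  let ?W = "affine_bits CARD('p) ?S"
  have "point_length (\<mu>, z) \<le> ?V" using st hd by (auto simp: explained_by_def)
  then have len: "vec_length \<mu> \<le> ?V" "rat_length z \<le> ?V" by (auto simp: point_length_def)
  have \<mu>: "frac_bits ?S (\<mu> $ i)" for i
    using rat_length_le_vec_length[of \<mu> i] len
    by (intro frac_bits_if_rat_length_le) (simp add: point_bits_def)
  have z: "frac_bits ?W z"
    using len by (intro frac_bits_if_rat_length_le) (simp add: affine_bits_def point_bits_def)
  have fs: "polyhedron_rep st = upper_region fs hs" "distinct (map (grid_cell \<epsilon>) fs)"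
      "\<And>ab. ab \<in> set fs \<Longrightarrow> small_coeffs (coeff_bits n) ab"
    using st by (auto simp: explained_by_def)
  have "runs (do {
      v \<leftarrow> eval_affine \<kappa> a b \<mu>;
      violated \<leftarrow> arith \<kappa> (\<lambda>v z. (1 - \<epsilon>) * of_rat v > of_rat z) v z;
      if violated then do {
        let A = phi a b # polyhedron_rep st;
        vs \<leftarrow> subroutine (enum A);
        State_Monad.return \<lparr>found = insert F (found st), polyhedron_rep = A, unexamined = vs\<rparr>}
      else State_Monad.return (st\<lparr>unexamined := tl (unexamined st)\<rparr>)})
      (affine_time \<kappa> CARD('p) ?S + (op_time \<kappa> ?W + ?V)) ?Q"
    if ab: "small_coeffs (coeff_bits n) (a, b)" for a b
  proof (rule runs_bind[OF runs_eval_affine])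
    have mono: "frac_bits ?S x" if "frac_bits (coeff_bits n) x" for x
      using that by (rule frac_bits_mono) (simp add: point_bits_def)
    show "frac_bits ?S a" "\<And>i. frac_bits ?S (b $ i)" using ab by (auto simp: small_coeffs_def intro: mono)
    show "\<And>i. frac_bits ?S (\<mu> $ i)" by (rule \<mu>)
    fix v assume v: "frac_bits ?W v \<and> v = a + (\<Sum>i\<in>UNIV. \<mu> $ i * b $ i)"
    show "runs (do {
      violated \<leftarrow> arith \<kappa> (\<lambda>v z. (1 - \<epsilon>) * of_rat v > of_rat z) v z;
      if violated then do {
        let A = phi a b # polyhedron_rep st;
        vs \<leftarrow> subroutine (enum A);
        State_Monad.return \<lparr>found = insert F (found st), polyhedron_rep = A, unexamined = vs\<rparr>}
      else State_Monad.return (st\<lparr>unexamined := tl (unexamined st)\<rparr>)})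
      (op_time \<kappa> ?W + ?V) ?Q"
    proof (rule runs_bind[OF runs_arith[where Q = "\<lambda>r. r = ((1 - \<epsilon>) * of_rat v > (of_rat z :: real))"]])
      fix violated assume violated: "violated = ((1 - \<epsilon>) * of_rat v > (of_rat z :: real))"
      show "runs (if violated then do {
          let A = phi a b # polyhedron_rep st;
          vs \<leftarrow> subroutine (enum A);
          State_Monad.return \<lparr>found = insert F (found st), polyhedron_rep = A, unexamined = vs\<rparr>}
        else State_Monad.return (st\<lparr>unexamined := tl (unexamined st)\<rparr>)) ?V ?Q"
      proof (cases violated)
        case True
        \<comment> \<open>The grid cell used up by the new function pays for examining the new vertices.\<close>
        define fs' where "fs' = (a, b) # fs"
        have rep: "phi a b # polyhedron_rep st = upper_region fs' hs"
          by (simp add: fs fs'_def upper_region_def)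
        have "grid_cell \<epsilon> (a, b) \<notin> grid_cell \<epsilon> ` set fs"
          using violated_new_grid_cell[OF st _ ab, of \<mu> z] True violated v hd by simp
        then have dist: "distinct (map (grid_cell \<epsilon>) fs')" using fs by (simp add: fs'_def)
        have small': "small_coeffs (coeff_bits n) ab" if "ab \<in> set fs'" for ab
          using that ab fs(3) unfolding fs'_def by (metis set_ConsD)
        have len': "length fs' \<le> ?N" by (rule length_le_grid_size[OF \<epsilon> small' dist])
        have dec: "remaining st' < remaining st" if st': "explained_by st' fs'" for st'
        proof -
          have "length (unexamined st') < ?V + 1" using st' by (simp add: explained_by_def)
          then have "remaining st' < (?N - length fs') * (?V + 1) + (?V + 1)"
            using st' by (simp add: remaining_def explained_by_def upper_region_def cylinder_def)
          also have "\<dots> = (?N - length fs' + 1) * (?V + 1)" by simp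
          also have "?N - length fs' + 1 = ?N - length fs" using len' by (simp add: fs'_def)
          also have "(?N - length fs) * (?V + 1) \<le> remaining st"
            by (simp add: remaining_def fs upper_region_def cylinder_def)
          finally show ?thesis .
        qed
        show ?thesis
          using True unfolding Let_def rep
          by (auto intro!: runs_mono[OF new_polyhedron[OF _ small' dist] order_refl] dec simp: fs'_def[symmetric])
            (auto simp: fs'_def)
      next
        case False
        have "explained_by (st\<lparr>unexamined := us\<rparr>) fs" using st hd by (auto simp: explained_by_def)
        moreover have "remaining (st\<lparr>unexamined := us\<rparr>) < remaining st" by (simp add: remaining_def hd)
        ultimately have "?Q (st\<lparr>unexamined := tl (unexamined st)\<rparr>)" by (auto simp: hd)
        then have "runs (State_Monad.return (st\<lparr>unexamined := tl (unexamined st)\<rparr>)) 0 ?Q"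
          by (rule runs_return)
        then have "runs (State_Monad.return (st\<lparr>unexamined := tl (unexamined st)\<rparr>)) ?V ?Q"
          by (rule runs_mono) auto
        with False show ?thesis by simp
      qed
    qed (use v z in auto)
  qed
  then have "runs (greedy_basis \<kappa> ind I \<mu>\<^sub>0 F \<bind> (\<lambda>B. basis_coeffs \<kappa> I B \<bind> (\<lambda>(a, b). do {
     v \<leftarrow> eval_affine \<kappa> a b \<mu>;
     violated \<leftarrow> arith \<kappa> (\<lambda>v z. (1 - \<epsilon>) * of_rat v > of_rat z) v z;
     if violated then do {
       let A = phi a b # polyhedron_rep st;
       vs \<leftarrow> subroutine (enum A);
       State_Monad.return \<lparr>found = insert F (found st), polyhedron_rep = A, unexamined = vs\<rparr>}
     else State_Monad.return (st\<lparr>unexamined := tl (unexamined st)\<rparr>)})))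
     (greedy_time \<kappa> Qi CARD('p) n ?S + (coeffs_time \<kappa> CARD('p) n +
       (affine_time \<kappa> CARD('p) ?S + (op_time \<kappa> ?W + ?V)))) ?Q"
    by (intro greedy_coeffs) auto
  then show ?thesis by (rule runs_mono) (simp_all add: step_time_def)
qed

text \<open>
  Each pass decreases the potential by at least \<open>1\<close> and takes at most \<open>step_time\<close> plus one oracle
  call. The invariant on the clock charges one such amount for the initialization and one for
  every unit by which the potential has fallen below \<open>steps_bound\<close>.
\<close>

lemma loop_terminates:
  fixes orc :: "'p ratvec \<Rightarrow> 'e set \<times> nat"
  assumes clk: "elapsed clk \<le> poly Qp n" "slowest_call clk = 0"
  shows "\<exists>st clk'. while_option
      (\<lambda>(st, clk). unexamined st \<noteq> [])
      (\<lambda>(st, clk). run_state (examine_vertex \<kappa> ind enum orc \<epsilon> I \<mu>\<^sub>0 st) clk)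
      (run_state (cell_init \<kappa> ind enum orc I hs \<mu>\<^sub>0) clk) = Some (st, clk') \<and>
    elapsed clk' \<le> poly Qp n +
      (steps_bound Qe CARD('p) n + 1) * (step_time \<kappa> Qi Qp Qe CARD('p) n + slowest_call clk')"
proof -
  let ?T = "step_time \<kappa> Qi Qp Qe CARD('p) n"
  let ?M = "steps_bound Qe CARD('p) n"
  let ?b = "\<lambda>(st :: ('e, 'p) cell_state, clk :: clock). unexamined st \<noteq> []"
  let ?c = "\<lambda>(st, clk). run_state (examine_vertex \<kappa> ind enum orc \<epsilon> I \<mu>\<^sub>0 st) clk"
  let ?s = "run_state (cell_init \<kappa> ind enum orc I hs \<mu>\<^sub>0) clk"
  define P where "P s \<longleftrightarrow> (\<exists>fs. explained_by (fst s) fs) \<and>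
      elapsed (snd s) \<le> poly Qp n + (?M + 1 - remaining (fst s)) * (?T + slowest_call (snd s))"
    for s :: "('e, 'p) cell_state \<times> clock"
  have init: "P ?s"
  proof -
    have "runs_with_oracle_call (cell_init \<kappa> ind enum orc I hs \<mu>\<^sub>0) ?T (\<lambda>st. \<exists>fs. explained_by st fs)"
      unfolding cell_init_def by (rule runs_with_oracle_call_bind) (rule runs_init)
    then have run: "elapsed (snd ?s) \<le> elapsed clk + ?T + slowest_call (snd ?s)"
      "\<exists>fs. explained_by (fst ?s) fs"
      by (auto simp: runs_with_oracle_call_def)
    then obtain fs where fs: "explained_by (fst ?s) fs" by blast
    have "elapsed (snd ?s) \<le> poly Qp n + 1 * (?T + slowest_call (snd ?s))"
      using run(1) clk(1) by simp
    also have "\<dots> \<le> poly Qp n + (?M + 1 - remaining (fst ?s)) * (?T + slowest_call (snd ?s))"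
      using remaining_le[OF fs] by (intro add_left_mono mult_le_mono1) simp
    finally have "elapsed (snd ?s) \<le>
        poly Qp n + (?M + 1 - remaining (fst ?s)) * (?T + slowest_call (snd ?s))" .
    with fs show ?thesis by (auto simp: P_def)
  qed
  have step: "P (?c s) \<and> remaining (fst (?c s)) < remaining (fst s)" if "P s" "?b s" for s
  proof -
    obtain st clk where s: "s = (st, clk)" by force
    obtain fs where fs: "explained_by st fs" using \<open>P s\<close> by (auto simp: P_def s)
    obtain \<mu> z us where hd: "unexamined st = (\<mu>, z) # us"
      using \<open>?b s\<close> by (cases "unexamined st") (auto simp: s)
    have c: "?c s = run_state (examine_vertex \<kappa> ind enum orc \<epsilon> I \<mu>\<^sub>0 st) clk" by (simp add: s)
    have hd': "hd (unexamined st) = (\<mu>, z)" by (simp add: hd)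
    have "runs_with_oracle_call (examine_vertex \<kappa> ind enum orc \<epsilon> I \<mu>\<^sub>0 st) ?T
        (\<lambda>st'. (\<exists>fs. explained_by st' fs) \<and> remaining st' < remaining st)"
      unfolding examine_vertex_def hd' Let_def[of "(\<mu>, z)"] prod.case
      by (rule runs_with_oracle_call_bind) (rule runs_examine[OF fs hd])
    then have run: "elapsed (snd (?c s)) \<le> elapsed clk + ?T + slowest_call (snd (?c s))"
        "slowest_call clk \<le> slowest_call (snd (?c s))"
        "\<exists>fs. explained_by (fst (?c s)) fs" "remaining (fst (?c s)) < remaining st"
      unfolding c by (auto simp: runs_with_oracle_call_def)
    let ?t = "?T + slowest_call (snd (?c s))"
    have "elapsed clk \<le> poly Qp n + (?M + 1 - remaining st) * (?T + slowest_call clk)"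
      using \<open>P s\<close> by (simp add: P_def s)
    also have "\<dots> \<le> poly Qp n + (?M + 1 - remaining st) * ?t"
      using run(2) by (intro add_left_mono mult_le_mono2) simp
    finally have "elapsed (snd (?c s)) \<le> poly Qp n + (?M + 1 - remaining st + 1) * ?t"
      using run(1) by simp
    also have "\<dots> \<le> poly Qp n + (?M + 1 - remaining (fst (?c s))) * ?t"
      using run(4) remaining_le[OF fs] by (intro add_left_mono mult_le_mono1) simp
    finally show ?thesis using run(3,4) by (auto simp: P_def s)
  qed
  have "\<exists>t. while_option ?b ?c ?s = Some t"
    by (rule measure_while_option_Some[where P = P and f = "\<lambda>s. remaining (fst s)"]) (use step init in auto)
  then obtain t where t: "while_option ?b ?c ?s = Some t" ..
  have "P t" by (rule while_option_rule[where P = P, OF _ t init]) (use step in auto)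
  then have "elapsed (snd t) \<le> poly Qp n + (?M + 1 - remaining (fst t)) * (?T + slowest_call (snd t))"
    by (simp add: P_def)
  also have "\<dots> \<le> poly Qp n + (?M + 1) * (?T + slowest_call (snd t))"
    by (intro add_left_mono mult_le_mono1) simp
  finally show ?thesis using t by (intro exI[of _ "fst t"] exI[of _ "snd t"]) simp
qed

end

section \<open>Sizes in terms of the encoding length\<close>

lemma small_instance_encoding_length:
  fixes I :: "('e, 'p::finite) interdiction"
  assumes "encoding_length I \<le> n" "budget I \<le> length (elements I)"
  shows "small_instance n I"
proof -
  let ?g = "\<lambda>e. rat_length (const_coeff I e) + vec_length (lin_coeff I e)"
  have sum: "(\<Sum>e\<leftarrow>elements I. ?g e) \<le> n" and code: "length (matroid_code I) \<le> n"
    using assms(1) by (auto simp: encoding_length_def)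
  have "1 \<le> ?g e" for e using rat_length_pos[of "const_coeff I e"] by simp
  then have "length (elements I) \<le> (\<Sum>e\<leftarrow>elements I. ?g e)" by (rule length_le_sum_list)
  with sum have len: "length (elements I) \<le> n" by simp
  have "rat_length (const_coeff I e) \<le> n" "rat_length (lin_coeff I e $ i) \<le> n" if "e \<in> ground I" for e i
    using member_le_sum_list[of "?g e" "map ?g (elements I)"] that sum
      rat_length_le_vec_length[of "lin_coeff I e" i] by (auto simp: ground_def)
  with assms(2) len code show ?thesis
    by (auto simp: small_instance_def intro: frac_bits_if_rat_length_le)
qed

text \<open>
  The list has no repetitions, so that its length is bounded by the number of pairs of elements
  and of half-spaces of the parameter polytope.
\<close>

lemma small_halfspaces_describes_cell:
  fixes I :: "('e, 'p::finite) interdiction"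
  assumes "small_instance n I" "encoding_length I \<le> n" "describes_cell I c hs"
  shows "small_halfspaces n hs"
proof -
  let ?P = "param_halfspaces I"
  let ?g = "\<lambda>(u, t). vec_length u + rat_length (t :: rat)"
  let ?h = "\<lambda>(e, f). (lin_coeff I e - lin_coeff I f, const_coeff I f - const_coeff I e)"
  have sum: "(\<Sum>x\<leftarrow>?P. ?g x) \<le> n" using assms(2) by (auto simp: encoding_length_def)
  have "1 \<le> ?g x" for x using rat_length_pos[of "snd x"] by (simp add: case_prod_beta)
  then have "length ?P \<le> (\<Sum>x\<leftarrow>?P. ?g x)" by (rule length_le_sum_list)
  with sum have lenP: "length ?P \<le> n" by simp
  have sub: "set hs \<subseteq> ?h ` (ground I \<times> ground I) \<union> set ?P"
    using assms(3) unfolding describes_cell_def arrangement_halfspaces_def by auto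
  have g: "finite (ground I)" "card (ground I) \<le> n"
    using assms(1) card_length[of "elements I"] by (auto simp: small_instance_def ground_def)
  have "length hs = card (set hs)"
    using assms(3) by (simp add: describes_cell_def distinct_card)
  also have "\<dots> \<le> card (?h ` (ground I \<times> ground I) \<union> set ?P)"
    using g by (intro card_mono[OF _ sub]) auto
  also have "\<dots> \<le> card (?h ` (ground I \<times> ground I)) + card (set ?P)"
    by (rule card_Un_le)
  also have "\<dots> \<le> card (ground I \<times> ground I) + length ?P"
    using g by (intro add_mono card_image_le card_length) auto
  also have "\<dots> \<le> n * n + n"
    using g lenP by (simp add: card_cartesian_product add_mono mult_le_mono)
  finally have len: "length hs \<le> n * n + n" .
  have bits: "(\<forall>i. frac_bits (2 * n + 1) (u $ i)) \<and> frac_bits (2 * n + 1) t" if "(u, t) \<in> set hs" for u t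
  proof -
    have "(u, t) \<in> ?h ` (ground I \<times> ground I) \<union> set ?P" using that sub by blast
    then consider e f where "e \<in> ground I" "f \<in> ground I" "u = lin_coeff I e - lin_coeff I f"
        "t = const_coeff I f - const_coeff I e" | "(u, t) \<in> set ?P"
      by auto
    then show ?thesis
    proof cases
      case (1 e f)
      then have "frac_bits (n + n + 1) (u $ i)" "frac_bits (n + n + 1) t" for i
        using assms(1) unfolding 1(3,4) vector_minus_component
        by (intro frac_bits_diff; simp add: small_instance_def)+
      then show ?thesis by (simp add: mult_2)
    next
      case 2
      have "vec_length u + rat_length t \<le> n"
        using member_le_sum_list[of "?g (u, t)" "map ?g ?P"] 2 sum by force
      then have "rat_length (u $ i) \<le> 2 * n + 1" "rat_length t \<le> 2 * n + 1" for i
        using rat_length_le_vec_length[of u i] by auto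
      then show ?thesis by (blast intro: frac_bits_if_rat_length_le)
    qed
  qed
  from len bits show ?thesis by (auto simp: small_halfspaces_def)
qed

section \<open>Polynomial bounds\<close>

definition polynomially_bounded :: "(nat \<Rightarrow> nat) \<Rightarrow> bool" where
  "polynomially_bounded f \<longleftrightarrow> (\<exists>p. \<forall>n. f n \<le> poly p n)"

lemma polynomially_bounded_const: "polynomially_bounded (\<lambda>n. c)"
  unfolding polynomially_bounded_def by (rule exI[of _ "[:c:]"]) simp

lemma polynomially_bounded_id: "polynomially_bounded (\<lambda>n. n)"
  unfolding polynomially_bounded_def by (rule exI[of _ "[:0, 1:]"]) simp

lemma polynomially_bounded_add:
  "polynomially_bounded f \<Longrightarrow> polynomially_bounded g \<Longrightarrow> polynomially_bounded (\<lambda>n. f n + g n)"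
  unfolding polynomially_bounded_def by (metis poly_add add_mono)

lemma polynomially_bounded_mult:
  "polynomially_bounded f \<Longrightarrow> polynomially_bounded g \<Longrightarrow> polynomially_bounded (\<lambda>n. f n * g n)"
  unfolding polynomially_bounded_def by (metis poly_mult mult_le_mono)

lemma polynomially_bounded_power:
  "polynomially_bounded f \<Longrightarrow> polynomially_bounded (\<lambda>n. f n ^ k)"
  by (induction k) (simp_all add: polynomially_bounded_const polynomially_bounded_mult)

lemma polynomially_bounded_poly:
  "polynomially_bounded f \<Longrightarrow> polynomially_bounded (\<lambda>n. poly p (f n))"
  by (induction p)
    (simp_all add: polynomially_bounded_const polynomially_bounded_add polynomially_bounded_mult)

lemmas polynomially_bounded_intros =
  polynomially_bounded_const polynomially_bounded_id polynomially_bounded_add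
  polynomially_bounded_mult polynomially_bounded_power polynomially_bounded_poly

lemma polynomially_bounded_vertex_bound: "polynomially_bounded (\<lambda>n. vertex_bound Q p n)"
  unfolding vertex_bound_def facet_bound_def halfspace_bound_def grid_size_def coeff_bits_def
  by (intro polynomially_bounded_intros)

lemma polynomially_bounded_point_bits: "polynomially_bounded (\<lambda>n. point_bits Qp Qe p n)"
  unfolding point_bits_def coeff_bits_def
  by (intro polynomially_bounded_intros polynomially_bounded_vertex_bound)

lemma polynomially_bounded_steps_bound: "polynomially_bounded (\<lambda>n. steps_bound Q p n)"
  unfolding steps_bound_def grid_size_def coeff_bits_def
  by (intro polynomially_bounded_intros polynomially_bounded_vertex_bound)

lemma polynomially_bounded_step_time: "polynomially_bounded (\<lambda>n. step_time \<kappa> Qi Qp Qe p n)"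
  unfolding step_time_def greedy_time_def coeffs_time_def affine_time_def op_time_def affine_bits_def
    coeff_bits_def halfspace_bound_def
  by (intro polynomially_bounded_intros polynomially_bounded_vertex_bound polynomially_bounded_point_bits)

text \<open>
  The variable \<open>n\<close> is to be instantiated by \<open>\<lceil>1 / \<epsilon>\<rceil>\<close> plus the encoding length; rounding accounts
  for the summand \<open>1\<close>. The polynomial is \<open>p\<close> evaluated at the sum of the first two variables and
  \<open>1\<close>, in Horner form.
\<close>

lemma poly3_bound:
  fixes p :: "nat poly"
  shows "\<exists>P. \<forall>x y z n. 0 \<le> x \<longrightarrow> 0 \<le> y \<longrightarrow> real n \<le> x + y + 1 \<longrightarrow> real (poly p n) \<le> poly3 P x y z"
proof (induction p)
  case 0
  show ?case by (rule exI[of _ 0]) (simp add: poly3_def)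
next
  case (pCons a p)
  then obtain P where P: "real (poly p n) \<le> poly3 P x y z"
    if "0 \<le> x" "0 \<le> y" "real n \<le> x + y + 1" for x y z n
    by blast
  let ?P = "[:[:[:real a:]:]:] + ([:0, 1:] + [:[:0, 1:]:] + 1) * P"
  have "poly3 ?P x y z = real a + (x + y + 1) * poly3 P x y z" for x y z
    by (simp add: poly3_def)
  moreover have "real (poly (pCons a p) n) \<le> real a + (x + y + 1) * poly3 P x y z"
    if "0 \<le> x" "0 \<le> y" "real n \<le> x + y + 1" for x y z n
    using P[OF that] that by (auto intro!: mult_mono)
  ultimately show ?case by (intro exI[of _ ?P]) auto
qed

section \<open>The running time of the Cell Algorithm\<close>

theorem theorem4p3:
  fixes \<kappa> :: "nat poly"
    and ind :: "bool list \<Rightarrow> 'e set \<Rightarrow> bool \<times> nat"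
    and pick :: "('e, 'p::{finite, linorder}) interdiction \<Rightarrow> ('p ratvec \<times> rat) list \<Rightarrow> 'p ratvec \<times> nat"
    and enum :: "'p halfspace list \<Rightarrow> 'p point list \<times> nat"
  assumes "polynomial_independence_test ind"
    and "interior_point_routine ind pick"
    and "chazelle_enumeration enum"
  shows "\<exists>P :: real poly poly poly.
    \<forall>(I :: ('e, 'p) interdiction) c hs (\<epsilon> :: real) (\<beta> :: real)
     (orc :: 'p ratvec \<Rightarrow> 'e set \<times> nat).
      interdiction_instance ind I \<longrightarrow>
      cell I c \<longrightarrow> describes_cell I c hs \<longrightarrow>
      0 < \<epsilon> \<longrightarrow> \<epsilon> < 1 \<longrightarrow> 0 < \<beta> \<longrightarrow> \<beta> \<le> 1 \<longrightarrow>
      approx_oracle \<beta> I orc \<longrightarrow>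
      (\<exists>S clk. cell_algorithm \<kappa> ind pick enum orc I \<epsilon> hs = Some (S, clk) \<and>
         real (elapsed clk) \<le>
           poly3 P (1 / \<epsilon>) (real (encoding_length I)) (real (slowest_call clk)))"
proof -
  obtain Qi :: "nat poly" where Qi: "\<And>d X. finite X \<Longrightarrow> snd (ind d X) \<le> poly Qi (length d + card X)"
    using assms(1) by (auto simp: polynomial_independence_test_def)
  obtain Qp :: "nat poly" where Qp: "\<And>I c hs. interdiction_instance ind I \<Longrightarrow> cell I c \<Longrightarrow> describes_cell I c hs \<Longrightarrow>
      real_vec (fst (pick I hs)) \<in> rel_interior c \<and> vec_length (fst (pick I hs)) \<le> snd (pick I hs) \<and>
      snd (pick I hs) \<le> poly Qp (encoding_length I)"
    using assms(2) unfolding interior_point_routine_def case_prod_beta by blast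
  obtain Qe :: "nat poly" where Qe: "enumerates_vertices_within Qe enum"
    using assms(3) unfolding chazelle_enumeration_def enumerates_vertices_within_def by blast
  let ?M = "steps_bound Qe CARD('p)" and ?T = "step_time \<kappa> Qi Qp Qe CARD('p)"
  have "polynomially_bounded (\<lambda>n. poly Qp n + (?M n + 1) * ?T n)" "polynomially_bounded (\<lambda>n. ?M n + 1)"
    by (intro polynomially_bounded_intros polynomially_bounded_steps_bound polynomially_bounded_step_time)+
  then obtain R1 R2 :: "nat poly" where R: "\<And>n. poly Qp n + (?M n + 1) * ?T n \<le> poly R1 n"
      "\<And>n. ?M n + 1 \<le> poly R2 n"
    unfolding polynomially_bounded_def by blast
  obtain P1 P2 where P: "\<And>x y z n. 0 \<le> x \<Longrightarrow> 0 \<le> y \<Longrightarrow> real n \<le> x + y + 1 \<Longrightarrow>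
      real (poly R1 n) \<le> poly3 P1 x y z \<and> real (poly R2 n) \<le> poly3 P2 x y z"
    using poly3_bound[of R1] poly3_bound[of R2] by metis
  \<comment> \<open>The time is linear in the slowest oracle call, the third variable.\<close>
  define P where "P = P1 + P2 * [:[:[:0, 1:]:]:]"
  have P_eq: "poly3 P x y z = poly3 P1 x y z + poly3 P2 x y z * z" for x y z
    by (simp add: P_def poly3_def)
  show ?thesis
  proof (intro exI[of _ P] allI impI)
    fix I :: "('e, 'p) interdiction" and c hs and \<epsilon> \<beta> :: real
      and orc :: "'p ratvec \<Rightarrow> 'e set \<times> nat"
    assume I: "interdiction_instance ind I" and c: "cell I c" "describes_cell I c hs"
      and \<epsilon>: "0 < \<epsilon>" and orc: "approx_oracle \<beta> I orc"
    let ?L = "encoding_length I"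
    define \<mu>\<^sub>0 t where "\<mu>\<^sub>0 = fst (pick I hs)" and "t = snd (pick I hs)"
    define n where "n = nat \<lceil>1 / \<epsilon>\<rceil> + ?L"
    have std: "standing_assumptions I" using I by (simp add: interdiction_instance_def)
    have region: "region hs = c" using c(2) by (simp add: describes_cell_def)
    have sub: "c \<subseteq> param_set I"
      using std c(1) by (intro cell_subset_param_set) (auto simp: standing_assumptions_def)
    have start: "real_vec \<mu>\<^sub>0 \<in> c" "vec_length \<mu>\<^sub>0 \<le> t" "t \<le> poly Qp ?L"
      using Qp[OF I c] rel_interior_subset by (auto simp: \<mu>\<^sub>0_def t_def)
    have t: "t \<le> poly Qp n"
      using start(3) poly_nat_mono[of ?L n Qp] by (simp add: n_def)
    \<comment> \<open>The budget is encoded in binary, so its size is bounded through the existence of a strategy.\<close>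
    have "fst (orc \<mu>\<^sub>0) \<in> strategies I"
      using orc start(1) sub by (auto simp: approx_oracle_def)
    then have "budget I \<le> card (ground I)"
      using card_mono[of "ground I" "fst (orc \<mu>\<^sub>0)"] by (auto simp: strategies_def ground_def)
    then have budget: "budget I \<le> length (elements I)"
      using card_length[of "elements I"] by (simp add: ground_def)
    have small: "small_instance n I"
      by (rule small_instance_encoding_length[OF _ budget]) (simp add: n_def)
    interpret cell_run \<kappa> Qi Qp Qe ind enum I \<epsilon> n hs \<mu>\<^sub>0
    proof
      show "1 / \<epsilon> \<le> real n" unfolding n_def using real_nat_ceiling_ge[of "1 / \<epsilon>"] by simp
      show "small_halfspaces n hs"
        by (rule small_halfspaces_describes_cell[OF small _ c(2)]) (simp add: n_def)
      show "0 \<le> const_coeff I e \<and> (\<forall>i. 0 \<le> lin_coeff I e $ i)" if "e \<in> ground I" for e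
        using std that by (auto simp: standing_assumptions_def)
      show "0 \<le> \<mu> $ i" if "\<mu> \<in> region hs" for \<mu> i
        using std that sub region by (auto simp: standing_assumptions_def)
      show "vec_length \<mu>\<^sub>0 \<le> poly Qp n" using start(2) t by simp
    qed (fact \<epsilon> small Qi Qe interior_cell[OF c])+
    obtain st clk where loop: "while_option
        (\<lambda>(st, clk). unexamined st \<noteq> [])
        (\<lambda>(st, clk). run_state (examine_vertex \<kappa> ind enum orc \<epsilon> I \<mu>\<^sub>0 st) clk)
        (run_state (cell_init \<kappa> ind enum orc I hs \<mu>\<^sub>0) \<lparr>elapsed = t, slowest_call = 0\<rparr>) = Some (st, clk)"
      and time: "elapsed clk \<le> poly Qp n + (?M n + 1) * (?T n + slowest_call clk)"
      using loop_terminates[of "\<lparr>elapsed = t, slowest_call = 0\<rparr>" orc] t by auto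
    have alg: "cell_algorithm \<kappa> ind pick enum orc I \<epsilon> hs = Some (found st, clk)"
      using loop by (simp add: cell_algorithm_def subroutine_def \<mu>\<^sub>0_def t_def case_prod_beta)
    have "real n \<le> 1 / \<epsilon> + real ?L + 1"
      using \<epsilon> of_nat_ceiling[of "1 / \<epsilon>"] unfolding n_def by (simp add: of_nat_nat)
    from P[OF _ _ this, of "real (slowest_call clk)"] \<epsilon>
    have R_le: "real (poly R1 n) \<le> poly3 P1 (1 / \<epsilon>) (real ?L) (real (slowest_call clk))"
        "real (poly R2 n) \<le> poly3 P2 (1 / \<epsilon>) (real ?L) (real (slowest_call clk))"
      by auto
    have "elapsed clk \<le> (poly Qp n + (?M n + 1) * ?T n) + (?M n + 1) * slowest_call clk"
      using time by (simp add: distrib_left)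
    also have "\<dots> \<le> poly R1 n + poly R2 n * slowest_call clk"
      by (intro add_mono mult_le_mono1 R)
    finally have "real (elapsed clk) \<le> real (poly R1 n) + real (poly R2 n) * real (slowest_call clk)"
      by (metis of_nat_add of_nat_le_iff of_nat_mult)
    also have "\<dots> \<le> poly3 P (1 / \<epsilon>) (real ?L) (real (slowest_call clk))"
      unfolding P_eq by (intro add_mono mult_right_mono R_le) simp
    finally show "\<exists>S clk. cell_algorithm \<kappa> ind pick enum orc I \<epsilon> hs = Some (S, clk) \<and>
         real (elapsed clk) \<le> poly3 P (1 / \<epsilon>) (real ?L) (real (slowest_call clk))"
      using alg by blast
  qed
qed

end
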